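(* Let $\Bbbk$ be a field, let $X$ be a (finite, bounded) polyhedral complex which can be embedded in $\mathbb{R}^d$, let $B$ be a finite set, and let $\{C_i\}_{i\in B}$ be a family of induced subcomplexes of $X$. Label each vertex $v$ of $X$ by the square free monomial $\mathbf{x}^{\mathbf{a}_v}=\prod_{i\in B:\, v\notin C_i}x_i$ in $S=\Bbbk[x_i]_{i\in B}$. Suppose this monomial labelling gives a cellular resolution of the ideal $I$ generated by these monomials. Then every minimal prime ideal of $I$ has codimension $\le d+1$.
   Context: A (bounded) polyhedral complex $X$ is a finite family of convex polytopes such that all faces of a polytope in $X$ are in $X$, and the intersection of any two polytopes in $X$ is a face of both. The subcomplex induced by a set $V'$ of vertices consists of all faces of $X$ whose vertices all lie in $V'$; an induced subcomplex is one of this form. Given a labelling of the vertices $v$ by monomials $\mathbf{x}^{\mathbf{a}_v}$ in $S$, each face $F$ is labelled by $\mathbf{x}^{\mathbf{a}_F}=\mathrm{lcm}_{v\in F}\{\mathbf{x}^{\mathbf{a}_v}\}$ (the empty face, of dimension $-1$, has label $1$). The cellular complex $\mathcal{F}(X;\Bbbk)$ is the complex of free $S$-modules with terms $\mathcal{F}_i(X;\Bbbk)=\bigoplus_{\dim F=i} S F$, $i\ge -1$, and differential $$\partial_i(F)=\sum_{G \text{ facet of } F}\mathrm{sign}(G,F)\,\frac{\mathbf{x}^{\mathbf{a}_F}}{\mathbf{x}^{\mathbf{a}_G}}\,G,$$ where $\mathrm{sign}(G,F)\in\{1,-1\}$ are the incidence signs of the reduced chain complex of $X$. The labelling gives a cellular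 resolution of $I$ if $\mathcal{F}(X;\Bbbk)$ is a free resolution of $\mathrm{coker}\,\partial_0=S/I$ (not necessarily minimal). *)

theory Defs
  imports
    "HOL-Analysis.Analysis"
    "HOL-Library.Poly_Mapping"
    "HOL-Algebra.Ideal"
begin

section \<open>Polynomial rings, monomials, codimension\<close>

text \<open>A monomial is represented by its exponent vector \<open>m :: 'b \<Rightarrow>\<^sub>0 nat\<close>, a polynomial
  by the finitely supported function from exponent vectors to coefficients; multiplication
  on this type is the convolution product. The ring below is \<open>k[x_i]\<close> with \<open>i\<close> ranging over
  the subset \<open>B\<close> of the type \<open>'b\<close> of all variable names.\<close>

type_synonym 'b expo = "'b \<Rightarrow>\<^sub>0 nat"
type_synonym ('b, 'k) mpol = "('b \<Rightarrow>\<^sub>0 nat) \<Rightarrow>\<^sub>0 'k"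

definition poly_ring :: "'b set \<Rightarrow> ('b, 'k::field) mpol ring" where
  "poly_ring B =
    \<lparr>carrier = {p. \<forall>m \<in> Poly_Mapping.keys p. Poly_Mapping.keys m \<subseteq> B},
     mult = (*), one = 1, zero = 0, add = (+)\<rparr>"

definition monomial :: "'b expo \<Rightarrow> ('b, 'k::field) mpol" where
  "monomial m = Poly_Mapping.single m 1"

text \<open>Exponent vector of the least common multiple of a finite set of monomials: the pointwise
  maximum (the empty set of monomials has lcm 1).\<close>

definition lcm_expo :: "'b expo set \<Rightarrow> 'b expo" where
  "lcm_expo M = (\<Sum>i \<in> (\<Union>m\<in>M. Poly_Mapping.keys m).
      Poly_Mapping.single i (Max ((\<lambda>m. Poly_Mapping.lookup m i) ` M)))"

definition minimal_prime :: "('r, 'm) ring_scheme \<Rightarrow> 'r set \<Rightarrow> 'r set \<Rightarrow> bool" where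
  "minimal_prime R I P \<longleftrightarrow> primeideal P R \<and> I \<subseteq> P \<and>
     (\<forall>Q. primeideal Q R \<and> I \<subseteq> Q \<and> Q \<subseteq> P \<longrightarrow> Q = P)"

text \<open>Codimension (height) of a prime ideal: the supremum of the lengths of the strictly
  increasing chains of prime ideals that end in it.\<close>

definition codim :: "('r, 'm) ring_scheme \<Rightarrow> 'r set \<Rightarrow> enat" where
  "codim R P = Sup {enat n | n. \<exists>Q :: nat \<Rightarrow> 'r set.
     (\<forall>i\<le>n. primeideal (Q i) R) \<and> (\<forall>i<n. Q i \<subset> Q (Suc i)) \<and> Q n = P}"


section \<open>Polyhedral complexes\<close>

definition polyhedral_complex :: "'a::euclidean_space set set \<Rightarrow> bool" where
  "polyhedral_complex X \<longleftrightarrow> finite X \<and> (\<forall>F\<in>X. polytope F) \<and>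
     (\<forall>F\<in>X. \<forall>G. G face_of F \<longrightarrow> G \<in> X) \<and>
     (\<forall>F\<in>X. \<forall>G\<in>X. F \<inter> G face_of F \<and> F \<inter> G face_of G)"

definition vertices :: "'a::euclidean_space set set \<Rightarrow> 'a set" where
  "vertices X = {v. {v} \<in> X}"

definition induced_subcomplex :: "'a::euclidean_space set set \<Rightarrow> 'a set set \<Rightarrow> bool" where
  "induced_subcomplex X C \<longleftrightarrow>
     (\<exists>V \<subseteq> vertices X. C = {F \<in> X. \<forall>v. v extreme_point_of F \<longrightarrow> v \<in> V})"

text \<open>The notion \<^const>\<open>facet_of\<close> of the library excludes the empty face; here the
  empty face (of affine dimension -1) is a facet of every vertex, so that the complex is
  augmented.\<close>

definition is_facet :: "'a::euclidean_space set \<Rightarrow> 'a set \<Rightarrow> bool" where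
  "is_facet G F \<longleftrightarrow> G face_of F \<and> aff_dim G = aff_dim F - 1"

text \<open>Incidence signs \<open>\<epsilon> G F\<close> of the reduced chain complex of \<open>X\<close>: the last clause says that
  \<open>F \<mapsto> \<Sum> \<epsilon> G F \<cdot> G\<close>, summed over the facets \<open>G\<close> of \<open>F\<close>, squares to zero, and the one before
  it that it augments every vertex to 1. Such signs are unique up to reorienting faces.\<close>

definition incidence_signs ::
    "'a::euclidean_space set set \<Rightarrow> ('a set \<Rightarrow> 'a set \<Rightarrow> int) \<Rightarrow> bool" where
  "incidence_signs X \<epsilon> \<longleftrightarrow>
     (\<forall>F\<in>X. \<forall>G. is_facet G F \<longrightarrow> \<epsilon> G F \<in> {1, -1}) \<and>
     (\<forall>v \<in> vertices X. \<epsilon> {} {v} = 1) \<and>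
     (\<forall>F\<in>X. \<forall>H\<in>X. (\<Sum>G | is_facet H G \<and> is_facet G F. \<epsilon> H G * \<epsilon> G F) = 0)"


section \<open>Cellular resolutions\<close>

definition face_expo :: "('a::euclidean_space \<Rightarrow> 'b expo) \<Rightarrow> 'a set \<Rightarrow> 'b expo" where
  "face_expo a F = lcm_expo (a ` {v. v extreme_point_of F})"

text \<open>The free module with basis the \<open>i\<close>-dimensional faces; a chain \<open>c\<close> stands for the
  linear combination of the faces \<open>F\<close> with coefficients \<open>c F\<close>.\<close>

definition chains ::
    "'b set \<Rightarrow> 'a::euclidean_space set set \<Rightarrow> int \<Rightarrow> ('a set \<Rightarrow> ('b, 'k::field) mpol) set" where
  "chains B X i = {c. (\<forall>F. c F \<in> carrier (poly_ring B)) \<and>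
                      (\<forall>F. c F \<noteq> 0 \<longrightarrow> F \<in> X \<and> aff_dim F = i)}"

text \<open>The linear extension of the differential to all chains. The label of a facet \<open>G\<close> of
  \<open>F\<close> divides the label of \<open>F\<close>, so the subtraction of exponents is not truncated.\<close>

definition boundary ::
    "'a::euclidean_space set set \<Rightarrow> ('a set \<Rightarrow> 'a set \<Rightarrow> int) \<Rightarrow> ('a \<Rightarrow> 'b expo)
      \<Rightarrow> ('a set \<Rightarrow> ('b, 'k::field) mpol) \<Rightarrow> ('a set \<Rightarrow> ('b, 'k) mpol)" where
  "boundary X \<epsilon> a c = (\<lambda>G. \<Sum>F | F \<in> X \<and> is_facet G F.
      c F * (of_int (\<epsilon> G F) * monomial (face_expo a F - face_expo a G)))"

definition label_ideal ::
    "'b set \<Rightarrow> 'a::euclidean_space set set \<Rightarrow> ('a \<Rightarrow> 'b expo) \<Rightarrow> ('b, 'k::field) mpol set" where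
  "label_ideal B X a = genideal (poly_ring B) ((\<lambda>v. monomial (a v)) ` vertices X)"

text \<open>The free modules \<open>chains B X i\<close> for \<open>i \<ge> -1\<close> form a free resolution of \<open>S/I\<close>. The last
  two clauses say that the map sending a chain \<open>c\<close> of degree -1 to the class of its only
  coefficient \<open>c {}\<close> identifies the cokernel of the differential in degree 0 with \<open>S/I\<close>.\<close>

definition cellular_resolution ::
    "'b set \<Rightarrow> 'a::euclidean_space set set \<Rightarrow> ('a set \<Rightarrow> 'a set \<Rightarrow> int) \<Rightarrow> ('a \<Rightarrow> 'b expo)
      \<Rightarrow> ('b, 'k::field) mpol set \<Rightarrow> bool" where
  "cellular_resolution B X \<epsilon> a I \<longleftrightarrow>
     (\<forall>i\<ge>0. boundary X \<epsilon> a ` (chains B X (i + 1) :: ('a set \<Rightarrow> ('b, 'k) mpol) set) =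
             {c \<in> chains B X i. boundary X \<epsilon> a c = (\<lambda>_. 0)}) \<and>
     boundary X \<epsilon> a ` (chains B X 0 :: ('a set \<Rightarrow> ('b, 'k) mpol) set) =
       {c \<in> chains B X (-1). c {} \<in> I} \<and>
     (\<lambda>c. c {}) ` (chains B X (-1) :: ('a set \<Rightarrow> ('b, 'k) mpol) set) = carrier (poly_ring B)"

definition avoidance_label ::
    "'b set \<Rightarrow> ('b \<Rightarrow> 'a::euclidean_space set set) \<Rightarrow> 'a \<Rightarrow> 'b expo" where
  "avoidance_label B C v = (\<Sum>i | i \<in> B \<and> v \<notin> vertices (C i). Poly_Mapping.single i 1)"


section \<open>Consistency of the definitions\<close>

lemma lookup_lcm_expo:
  assumes "finite M"
  shows "Poly_Mapping.lookup (lcm_expo M) i =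
    (if M = {} then 0 else Max ((\<lambda>m. Poly_Mapping.lookup m i) ` M))"
proof -
  let ?K = "\<Union>m\<in>M. Poly_Mapping.keys m"
  have fin: "finite ?K" using assms by auto
  have "Poly_Mapping.lookup (lcm_expo M) i =
      (if i \<in> ?K then Max ((\<lambda>m. Poly_Mapping.lookup m i) ` M) else 0)"
    unfolding lcm_expo_def lookup_sum lookup_single using fin
    by (simp add: when_def)
  moreover have "Max ((\<lambda>m. Poly_Mapping.lookup m i) ` M) = 0" if "i \<notin> ?K" "M \<noteq> {}"
  proof -
    have "(\<lambda>m. Poly_Mapping.lookup m i) ` M = {0}"
      using that by (auto simp: in_keys_iff image_iff)
    then show ?thesis by simp
  qed
  ultimately show ?thesis by auto
qed

lemma cring_poly_ring: "cring (poly_ring B :: ('b, 'k::field) mpol ring)"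
proof (rule cringI)
  show "abelian_group (poly_ring B :: ('b, 'k) mpol ring)"
  proof (rule abelian_groupI)
    fix x y :: "('b, 'k) mpol"
    assume "x \<in> carrier (poly_ring B)" "y \<in> carrier (poly_ring B)"
    then show "x \<oplus>\<^bsub>poly_ring B\<^esub> y \<in> carrier (poly_ring B)"
      using keys_add[of x y] by (auto simp: poly_ring_def)
  next
    fix x :: "('b, 'k) mpol"
    assume "x \<in> carrier (poly_ring B)"
    then show "\<exists>y\<in>carrier (poly_ring B). y \<oplus>\<^bsub>poly_ring B\<^esub> x = \<zero>\<^bsub>poly_ring B\<^esub>"
      by (intro bexI[of _ "- x"]) (auto simp: poly_ring_def)
  qed (auto simp: poly_ring_def algebra_simps)
  show "Group.comm_monoid (poly_ring B :: ('b, 'k) mpol ring)"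
  proof (rule Group.comm_monoidI)
    fix x y :: "('b, 'k) mpol"
    assume A: "x \<in> carrier (poly_ring B)" "y \<in> carrier (poly_ring B)"
    have "Poly_Mapping.keys m \<subseteq> B" if m: "m \<in> Poly_Mapping.keys (x * y)" for m
    proof -
      obtain s t where "m = s + t" "s \<in> Poly_Mapping.keys x" "t \<in> Poly_Mapping.keys y"
        using m keys_mult[of x y] by blast
      then show ?thesis
        using A keys_add[of s t] unfolding poly_ring_def by fastforce
    qed
    then show "x \<otimes>\<^bsub>poly_ring B\<^esub> y \<in> carrier (poly_ring B)"
      by (simp add: poly_ring_def)
  qed (auto simp: poly_ring_def algebra_simps)
qed (auto simp: poly_ring_def algebra_simps)

end

theory Submission
  imports Defs
begin

text \<open>As \<open>I\<close> is generated by monomials, a minimal prime \<open>P\<close> of \<open>I\<close> is generated by a set \<open>T\<close> of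
variables that meets the label of every vertex and is minimal with this property
(\<open>minimal_prime_of_label_ideal\<close>). In terms of the complex, the subcomplexes of the faces whose label
avoids \<open>t\<close>, for \<open>t \<in> T\<close>, have no common vertex, but any proper subfamily of them has one.

The resolution says that the reduced homology of every intersection of such subcomplexes that contains
a vertex vanishes, and so does that of the whole complex (\<open>exact_at_strand\<close>): these are the
multigraded parts of the resolution. Since the intersection over all of \<open>T\<close> consists of the empty face
only, a repeated use of the long exact sequence of a pair, removing one subcomplex at a time, moves
the class of the empty face from degree \<open>-1\<close> to degree \<open>card T - 1\<close>
(\<open>exists_cell_outside_acyclic_cover\<close>). Hence \<open>X\<close> has a face of dimension \<open>card T - 1\<close>. This replaces
the comparison of the codimension of \<open>P\<close> with the projective dimension of \<open>S/I\<close> by an argument about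
chains of faces alone. The embedding enters through invariance of domain only: a face of a complex
embedded in \<open>\<real>\<^sup>d\<close> has dimension at most \<open>d\<close>, so \<open>card T \<le> d + 1\<close>.

It remains to see that the ideal generated by the variables in \<open>T\<close> has codimension at most \<open>card T\<close>
(\<open>codim_variable_prime_le\<close>). Prolonging a chain of primes by the remaining variables reduces this to
the bound \<open>card B\<close> on the length of all chains of primes. There, elements chosen at the steps of a
chain are algebraically independent, and counting monomials shows that a polynomial ring in
\<open>card B\<close> variables has no more than \<open>card B\<close> such elements.\<close>

section \<open>Chain complexes of cells and acyclic covers\<close>

definition cell_chain :: "'c set \<Rightarrow> ('c \<Rightarrow> int) \<Rightarrow> int \<Rightarrow> ('c \<Rightarrow> 'k::field) \<Rightarrow> bool" where
  "cell_chain Y dm i c \<longleftrightarrow> (\<forall>F. c F \<noteq> 0 \<longrightarrow> F \<in> Y \<and> dm F = i)"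

definition cell_bd :: "'c set \<Rightarrow> ('c \<Rightarrow> 'c \<Rightarrow> 'k::field) \<Rightarrow> ('c \<Rightarrow> 'k) \<Rightarrow> 'c \<Rightarrow> 'k" where
  "cell_bd Y inc c = (\<lambda>G. if G \<in> Y then \<Sum>F\<in>Y. inc G F * c F else 0)"

definition exact_at :: "'c set \<Rightarrow> ('c \<Rightarrow> int) \<Rightarrow> ('c \<Rightarrow> 'c \<Rightarrow> 'k::field) \<Rightarrow> int \<Rightarrow> bool" where
  "exact_at Y dm inc i \<longleftrightarrow> (\<forall>c. cell_chain Y dm i c \<and> cell_bd Y inc c = (\<lambda>_. 0) \<longrightarrow>
     (\<exists>b. cell_chain Y dm (i + 1) b \<and> cell_bd Y inc b = c))"

definition based_complex :: "'c set \<Rightarrow> ('c \<Rightarrow> int) \<Rightarrow> ('c \<Rightarrow> 'c \<Rightarrow> 'k::field) \<Rightarrow> bool" where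
  "based_complex Y dm inc \<longleftrightarrow> finite Y \<and>
     (\<forall>F\<in>Y. \<forall>G\<in>Y. inc G F \<noteq> 0 \<longrightarrow> dm G = dm F - 1) \<and>
     (\<forall>F\<in>Y. \<forall>H\<in>Y. (\<Sum>G\<in>Y. inc H G * inc G F) = 0)"

text \<open>Subcomplexes of a region \<open>Y\<close> of cells. Their complements are no longer subcomplexes, which is
why all notions above refer to an arbitrary region: the boundary is cut off at the region, and the
region \<open>Y - K\<close> carries the relative complex of the pair \<open>(Y, K)\<close>.\<close>

definition closed_cells :: "'c set \<Rightarrow> ('c \<Rightarrow> 'c \<Rightarrow> 'k::field) \<Rightarrow> 'c set \<Rightarrow> bool" where
  "closed_cells Y inc K \<longleftrightarrow> K \<subseteq> Y \<and> (\<forall>F\<in>K. \<forall>G\<in>Y. inc G F \<noteq> 0 \<longrightarrow> G \<in> K)"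

lemma cell_chain_bd:
  assumes "based_complex Y dm inc" "cell_chain Y dm i c"
  shows "cell_chain Y dm (i - 1) (cell_bd Y inc c)"
  unfolding cell_chain_def
proof (intro allI impI)
  fix G assume nz: "cell_bd Y inc c G \<noteq> 0"
  then have G: "G \<in> Y" by (auto simp: cell_bd_def split: if_splits)
  with nz have "(\<Sum>F\<in>Y. inc G F * c F) \<noteq> 0" by (simp add: cell_bd_def)
  then obtain F where "F \<in> Y" "inc G F * c F \<noteq> 0" by (meson sum.neutral)
  then have "inc G F \<noteq> 0" "dm F = i" "F \<in> Y"
    using assms(2) by (auto simp: cell_chain_def)
  with assms(1) G have "dm G = i - 1" unfolding based_complex_def by auto
  with G show "G \<in> Y \<and> dm G = i - 1" by simp
qed

lemma cell_bd_bd: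
  assumes "based_complex Y dm inc"
  shows "cell_bd Y inc (cell_bd Y inc c) = (\<lambda>_. 0)"
proof
  fix H
  have "(\<Sum>G\<in>Y. inc H G * (\<Sum>F\<in>Y. inc G F * c F)) = 0" if H: "H \<in> Y"
  proof -
    have "(\<Sum>G\<in>Y. inc H G * (\<Sum>F\<in>Y. inc G F * c F)) = (\<Sum>G\<in>Y. \<Sum>F\<in>Y. inc H G * inc G F * c F)"
      by (simp add: sum_distrib_left mult.assoc)
    also have "\<dots> = (\<Sum>F\<in>Y. \<Sum>G\<in>Y. inc H G * inc G F * c F)" by (rule sum.swap)
    also have "\<dots> = (\<Sum>F\<in>Y. (\<Sum>G\<in>Y. inc H G * inc G F) * c F)"
      by (simp add: sum_distrib_right)
    also have "\<dots> = 0"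
      using assms H by (intro sum.neutral) (simp add: based_complex_def)
    finally show ?thesis .
  qed
  then show "cell_bd Y inc (cell_bd Y inc c) H = 0" by (simp add: cell_bd_def)
qed

lemma cell_bd_diff: "cell_bd Y inc (\<lambda>F. b F - c F) = (\<lambda>G. cell_bd Y inc b G - cell_bd Y inc c G)"
  by (auto simp: cell_bd_def sum_subtractf right_diff_distrib)

lemma cell_bd_restrict:
  assumes "finite Y" "K \<subseteq> Y" "\<And>F. F \<notin> K \<Longrightarrow> c F = 0" "G \<in> K"
  shows "cell_bd K inc c G = cell_bd Y inc c G"
proof -
  have "(\<Sum>F\<in>K. inc G F * c F) = (\<Sum>F\<in>Y. inc G F * c F)"
    using assms by (intro sum.mono_neutral_left) auto
  with assms show ?thesis by (auto simp: cell_bd_def)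
qed

lemma cell_bd_closed_outside:
  assumes "closed_cells Y inc K" "\<And>F. F \<notin> K \<Longrightarrow> c F = 0" "G \<notin> K"
  shows "cell_bd Y inc c G = 0"
proof -
  have "inc G F * c F = 0" if "G \<in> Y" for F
    using that assms by (cases "F \<in> K") (auto simp: closed_cells_def)
  then have "(\<Sum>F\<in>Y. inc G F * c F) = 0" if "G \<in> Y"
    using that by (intro sum.neutral) blast
  then show ?thesis by (simp add: cell_bd_def)
qed

lemma cell_bd_closed:
  assumes "finite Y" "closed_cells Y inc K" "\<And>F. F \<notin> K \<Longrightarrow> c F = 0"
  shows "cell_bd K inc c = cell_bd Y inc c"
proof
  fix G
  show "cell_bd K inc c G = cell_bd Y inc c G"
  proof (cases "G \<in> K")
    case True
    then show ?thesis using assms by (intro cell_bd_restrict) (auto simp: closed_cells_def)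
  next
    case False
    have "cell_bd Y inc c G = 0" by (rule cell_bd_closed_outside[OF assms(2,3) False])
    with False show ?thesis by (simp add: cell_bd_def)
  qed
qed

lemma cell_chain_diff:
  assumes "cell_chain Y dm i b" "cell_chain Y dm i c"
  shows "cell_chain Y dm i (\<lambda>F. b F - c F)"
  using assms unfolding cell_chain_def by (metis diff_self)

text \<open>The composite of two cut-off boundaries only runs over cells lying between two cells of the region,
so it still vanishes when the region is convex for the facet relation.\<close>

lemma based_complex_convex:
  assumes Y: "based_complex Y dm inc" and "Z \<subseteq> Y"
    and cv: "\<And>F G H. F \<in> Z \<Longrightarrow> H \<in> Z \<Longrightarrow> G \<in> Y \<Longrightarrow> inc H G \<noteq> 0 \<Longrightarrow> inc G F \<noteq> 0 \<Longrightarrow> G \<in> Z"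
  shows "based_complex Z dm inc"
proof -
  have fin: "finite Y" using Y by (simp add: based_complex_def)
  have "(\<Sum>G\<in>Z. inc H G * inc G F) = (\<Sum>G\<in>Y. inc H G * inc G F)" if "F \<in> Z" "H \<in> Z" for F H
    using fin \<open>Z \<subseteq> Y\<close> cv[OF that] by (intro sum.mono_neutral_left) auto
  moreover have "finite Z" using fin \<open>Z \<subseteq> Y\<close> by (rule finite_subset[rotated])
  moreover have "dm G = dm F - 1" if "F \<in> Z" "G \<in> Z" "inc G F \<noteq> 0" for F G
    using Y \<open>Z \<subseteq> Y\<close> that unfolding based_complex_def by blast
  moreover have "(\<Sum>G\<in>Y. inc H G * inc G F) = 0" if "F \<in> Z" "H \<in> Z" for F H
    using Y \<open>Z \<subseteq> Y\<close> that unfolding based_complex_def by blast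
  ultimately show ?thesis
    unfolding based_complex_def by simp
qed

lemma based_complex_closed:
  assumes "based_complex Y dm inc" "closed_cells Y inc K"
  shows "based_complex K dm inc"
  using assms by (intro based_complex_convex[OF assms(1)]) (auto simp: closed_cells_def)

lemma cell_bd_quotient:
  assumes "finite Y" "closed_cells Y inc K" "G \<in> Y - K"
  shows "cell_bd (Y - K) inc c G = cell_bd Y inc c G"
proof -
  have "(\<Sum>F\<in>Y - K. inc G F * c F) = (\<Sum>F\<in>Y. inc G F * c F)"
    using assms by (intro sum.mono_neutral_left) (auto simp: closed_cells_def)
  with assms(3) show ?thesis by (simp add: cell_bd_def)
qed

text \<open>The next two lemmas are the parts of the long exact sequence of the pair \<open>(Y, K)\<close> that an
induction over the members of a cover uses. Here a relative cycle \<open>c\<close> has its boundary in \<open>K\<close>,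
where that boundary can be filled; correcting \<open>c\<close> by the filling gives a cycle of \<open>Y\<close>, and the
part outside \<open>K\<close> of a chain bounded by it bounds \<open>c\<close>.\<close>

lemma exact_at_quotient:
  assumes Y: "based_complex Y dm inc" and K: "closed_cells Y inc K"
    and exY: "exact_at Y dm inc i" and exK: "exact_at K dm inc (i - 1)"
  shows "exact_at (Y - K) dm inc i"
  unfolding exact_at_def
proof (intro allI impI, elim conjE)
  fix c :: "'a \<Rightarrow> 'b"
  assume c: "cell_chain (Y - K) dm i c" and cyc: "cell_bd (Y - K) inc c = (\<lambda>_. 0)"
  have fin: "finite Y" and KY: "K \<subseteq> Y"
    using Y K by (auto simp: based_complex_def closed_cells_def)
  have cY: "cell_chain Y dm i c" using c by (auto simp: cell_chain_def)
  define e where "e = cell_bd Y inc c"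
  have e0: "e F = 0" if "F \<notin> K" for F
    using cell_bd_restrict[OF fin, of "Y - K" c F inc] that c fun_cong[OF cyc, of F]
    by (cases "F \<in> Y") (auto simp: e_def cell_chain_def cell_bd_def)
  have eK: "cell_chain K dm (i - 1) e"
    using cell_chain_bd[OF Y cY] e0 by (fold e_def) (auto simp: cell_chain_def)
  have "cell_bd K inc e = (\<lambda>_. 0)"
    using cell_bd_closed[OF fin K, of e] e0 cell_bd_bd[OF Y] by (simp add: e_def)
  with exK eK obtain b where b: "cell_chain K dm i b" "cell_bd K inc b = e"
    unfolding exact_at_def by fastforce
  have b0: "b F = 0" if "F \<notin> K" for F using b that by (auto simp: cell_chain_def)
  have bY: "cell_bd Y inc b = e" using cell_bd_closed[OF fin K b0] b by simp
  have "cell_chain Y dm i (\<lambda>F. c F - b F)"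
    using cY b(1) KY by (intro cell_chain_diff) (auto simp: cell_chain_def)
  moreover have "cell_bd Y inc (\<lambda>F. c F - b F) = (\<lambda>_. 0)"
    by (simp add: cell_bd_diff bY) (simp add: e_def)
  ultimately obtain a where a: "cell_chain Y dm (i + 1) a" "cell_bd Y inc a = (\<lambda>F. c F - b F)"
    using exY unfolding exact_at_def by meson
  define a1 where "a1 = (\<lambda>F. if F \<in> K then 0 else a F)"
  have a1: "cell_chain (Y - K) dm (i + 1) a1"
    using a by (auto simp: cell_chain_def a1_def)
  have "cell_bd (Y - K) inc a1 G = c G" for G
  proof (cases "G \<in> Y - K")
    case True
    have "cell_bd (Y - K) inc a1 G = cell_bd (Y - K) inc a G"
      unfolding cell_bd_def a1_def by (auto intro!: sum.cong)
    also have "\<dots> = cell_bd Y inc a G" by (rule cell_bd_quotient[OF fin K True])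
    finally show ?thesis using a True b0 by simp
  next
    case False
    then show ?thesis using c by (auto simp: cell_bd_def cell_chain_def)
  qed
  with a1 show "\<exists>b. cell_chain (Y - K) dm (i + 1) b \<and> cell_bd (Y - K) inc b = c" by blast
qed

text \<open>As \<open>Y\<close> has no homology in degree \<open>i\<close>, the connecting map hits every class of \<open>K\<close>: a cycle \<open>e\<close>
of \<open>K\<close> bounds a chain \<open>a\<close> of \<open>Y\<close>, and the part of \<open>a\<close> outside \<open>K\<close> is a relative cycle. If that were a relative boundary
\<open>\<partial>b\<close>, then \<open>a - \<partial>b\<close> would lie in \<open>K\<close> and bound \<open>e\<close> there.\<close>

lemma not_exact_at_quotient:
  assumes Y: "based_complex Y dm inc" and K: "closed_cells Y inc K"
    and exY: "exact_at Y dm inc i" and exK: "\<not> exact_at K dm inc i"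
  shows "\<not> exact_at (Y - K) dm inc (i + 1)"
proof
  assume exQ: "exact_at (Y - K) dm inc (i + 1)"
  have fin: "finite Y" and KY: "K \<subseteq> Y"
    using Y K by (auto simp: based_complex_def closed_cells_def)
  obtain e where e: "cell_chain K dm i e" "cell_bd K inc e = (\<lambda>_. 0)"
    and ne: "\<And>b. cell_chain K dm (i + 1) b \<Longrightarrow> cell_bd K inc b \<noteq> e"
    using exK unfolding exact_at_def by blast
  have e0: "e F = 0" if "F \<notin> K" for F using e that by (auto simp: cell_chain_def)
  have "cell_chain Y dm i e" using e KY by (auto simp: cell_chain_def)
  moreover have "cell_bd Y inc e = (\<lambda>_. 0)" using cell_bd_closed[OF fin K e0] e by simp
  ultimately obtain a where a: "cell_chain Y dm (i + 1) a" "cell_bd Y inc a = e"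
    using exY unfolding exact_at_def by meson
  define a1 where "a1 = (\<lambda>F. if F \<in> K then 0 else a F)"
  have a1: "cell_chain (Y - K) dm (i + 1) a1"
    using a by (auto simp: cell_chain_def a1_def)
  have "cell_bd (Y - K) inc a1 G = 0" for G
  proof (cases "G \<in> Y - K")
    case True
    have "cell_bd (Y - K) inc a1 G = cell_bd (Y - K) inc a G"
      unfolding cell_bd_def a1_def by (auto intro!: sum.cong)
    also have "\<dots> = cell_bd Y inc a G" by (rule cell_bd_quotient[OF fin K True])
    finally show ?thesis using a True e0 by simp
  qed (auto simp: cell_bd_def)
  then obtain b where b: "cell_chain (Y - K) dm (i + 1 + 1) b" "cell_bd (Y - K) inc b = a1"
    using exQ a1 unfolding exact_at_def by blast
  have bY: "cell_chain Y dm (i + 1 + 1) b" using b by (auto simp: cell_chain_def)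
  define h where "h = (\<lambda>F. a F - cell_bd Y inc b F)"
  have h0: "h F = 0" if "F \<notin> K" for F
  proof (cases "F \<in> Y")
    case True
    then have "cell_bd Y inc b F = cell_bd (Y - K) inc b F"
      using b that by (intro cell_bd_restrict[OF fin, symmetric]) (auto simp: cell_chain_def)
    then show ?thesis using that by (simp add: h_def b a1_def)
  next
    case False
    then show ?thesis using a by (auto simp: h_def cell_bd_def cell_chain_def)
  qed
  have "cell_chain Y dm (i + 1) h"
    using a(1) cell_chain_bd[OF Y bY] unfolding h_def by (intro cell_chain_diff) (simp_all add: algebra_simps)
  with h0 have "cell_chain K dm (i + 1) h" by (auto simp: cell_chain_def)
  moreover have "cell_bd Y inc h = e"
    unfolding h_def cell_bd_diff cell_bd_bd[OF Y] by (simp add: a)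
  then have "cell_bd K inc h = e" using cell_bd_closed[OF fin K h0] by simp
  ultimately show False using ne by blast
qed

text \<open>A homological form of Helly's theorem. Each \<open>t \<in> T\<close> determines the subcomplex of the cells \<open>F\<close>
with \<open>t \<notin> \<tau> F\<close>. All intersections of fewer than \<open>card T\<close> of these subcomplexes are acyclic, the
empty intersection \<open>Y\<close> included, while the intersection of all of them has homology in degree \<open>q\<close>.
Passing to the cells with \<open>t \<in> \<tau> F\<close> removes one member of the cover: acyclic intersections stay
acyclic, and the homology of the total intersection moves from degree \<open>q\<close> to \<open>q + 1\<close>. After all
members are removed, a nonzero class in degree \<open>q + card T\<close> remains, carried by cells that lie in
none of the subcomplexes. Working with arbitrary regions rather than with subcomplexes is what makes
the hypothesis reproduce itself.\<close>

theorem exists_cell_outside_acyclic_cover: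
  assumes "finite T" "based_complex Y dm inc"
    and "\<And>F G. F \<in> Y \<Longrightarrow> G \<in> Y \<Longrightarrow> inc G F \<noteq> 0 \<Longrightarrow> \<tau> G \<subseteq> \<tau> F"
    and "\<And>A i. A \<subset> T \<Longrightarrow> exact_at {F\<in>Y. \<tau> F \<inter> A = {}} dm inc i"
    and "\<not> exact_at {F\<in>Y. \<tau> F \<inter> T = {}} dm inc q"
  shows "\<exists>F\<in>Y. T \<subseteq> \<tau> F \<and> dm F = q + int (card T)"
  using assms
proof (induction T arbitrary: Y q rule: finite_induct)
  case empty
  then obtain c where c: "cell_chain Y dm q c" "cell_bd Y inc c = (\<lambda>_. 0)"
    and nb: "\<And>b. cell_chain Y dm (q + 1) b \<Longrightarrow> cell_bd Y inc b \<noteq> c"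
    unfolding exact_at_def by auto
  have "c \<noteq> (\<lambda>_. 0)"
    using nb[of "\<lambda>_. 0"] by (auto simp: cell_chain_def cell_bd_def)
  then obtain F where "c F \<noteq> 0" by blast
  with c show ?case by (auto simp: cell_chain_def)
next
  case (insert t T)
  define L where "L A = {F\<in>Y. \<tau> F \<inter> A = {}}" for A
  define Z where "Z = {F\<in>Y. t \<in> \<tau> F}"
  have tau: "\<tau> G \<subseteq> \<tau> F" if "F \<in> Y" "G \<in> Y" "inc G F \<noteq> 0" for F G
    using insert.prems(2) that by blast
  have cl: "closed_cells Y inc (L A)" for A
    unfolding closed_cells_def
  proof (intro conjI ballI impI)
    fix F G assume "F \<in> L A" "G \<in> Y" "inc G F \<noteq> 0"
    then show "G \<in> L A" using tau[of F G] by (auto simp: L_def)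
  qed (auto simp: L_def)
  have L: "based_complex (L A) dm inc" for A
    by (rule based_complex_closed[OF insert.prems(1) cl])
  have clL: "closed_cells (L A) inc (L (insert t A))" for A
    unfolding closed_cells_def
  proof (intro conjI ballI impI)
    fix F G assume "F \<in> L (insert t A)" "G \<in> L A" "inc G F \<noteq> 0"
    then show "G \<in> L (insert t A)" using tau[of F G] by (auto simp: L_def)
  qed (auto simp: L_def)
  \<comment> \<open>Every intersection inside the smaller region is a relative complex of two intersections in Y.\<close>
  have Z: "{F\<in>Z. \<tau> F \<inter> A = {}} = L A - L (insert t A)" for A
    by (auto simp: Z_def L_def)
  have "\<exists>F\<in>Z. T \<subseteq> \<tau> F \<and> dm F = (q + 1) + int (card T)"
  proof (rule insert.IH)
    show "based_complex Z dm inc"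
    proof (rule based_complex_convex[OF insert.prems(1)])
      fix F G H assume "H \<in> Z" "G \<in> Y" "inc H G \<noteq> 0"
      then show "G \<in> Z" using tau[of G H] by (auto simp: Z_def)
    qed (simp add: Z_def)
    show "\<tau> G \<subseteq> \<tau> F" if "F \<in> Z" "G \<in> Z" "inc G F \<noteq> 0" for F G
      using tau[of F G] that by (simp add: Z_def)
    show "exact_at {F\<in>Z. \<tau> F \<inter> A = {}} dm inc i" if "A \<subset> T" for A i
      unfolding Z
    proof (rule exact_at_quotient[OF L clL])
      obtain x where x: "x \<in> T" "x \<notin> A" using \<open>A \<subset> T\<close> by blast
      then have "x \<noteq> t" using insert.hyps by blast
      then have "A \<subset> insert t T" "insert t A \<subset> insert t T" using \<open>A \<subset> T\<close> x by blast+
      then show "exact_at (L A) dm inc i" "exact_at (L (insert t A)) dm inc (i - 1)"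
        using insert.prems(3)[of A i] insert.prems(3)[of "insert t A" "i - 1"]
        unfolding L_def by blast+
    qed
    show "\<not> exact_at {F\<in>Z. \<tau> F \<inter> T = {}} dm inc (q + 1)"
      unfolding Z
    proof (rule not_exact_at_quotient[OF L clL])
      show "exact_at (L T) dm inc q" using insert.prems(3)[of T] insert.hyps by (auto simp: L_def)
      show "\<not> exact_at (L (insert t T)) dm inc q" using insert.prems(4) by (simp add: L_def)
    qed
  qed
  then show ?case using insert.hyps by (auto simp: Z_def)
qed

section \<open>Faces of an embedded complex\<close>

text \<open>Invariance of domain bounds the dimension of the convex set \<open>F\<close> by that of an affine set of vectors
into which it is mapped injectively, whereas \<^term>\<open>Euclidean_space d\<close> consists of sequences. When
\<open>d\<close> is less than the dimension of the ambient type, \<open>\<real>\<^sup>d\<close> is modelled as the span of \<open>d\<close> basis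
vectors of that type; otherwise the bound is trivial.\<close>

lemma aff_dim_face_le_embedding:
  fixes X :: "'a::euclidean_space set set"
  assumes X: "polyhedral_complex X" and F: "F \<in> X"
    and emb: "embedding_map (top_of_set (\<Union>X)) (Euclidean_space d) f"
  shows "aff_dim F \<le> int d"
proof (cases "DIM('a) \<le> d")
  case True
  then show ?thesis using aff_dim_le_DIM[of F] by linarith
next
  case False
  then obtain D :: "'a set" where D: "D \<subseteq> Basis" "card D = d"
    using obtain_subset_with_card_n[of d "Basis :: 'a set"] by auto
  have finD: "finite D" by (rule finite_subset[OF D(1) finite_Basis])
  obtain h where h: "bij_betw h {..<d} D"
    using ex_bij_betw_nat_finite[OF finD] D by (auto simp: lessThan_atLeast0)
  define g :: "'a \<Rightarrow> 'a" where "g x = (\<Sum>i<d. f x i *\<^sub>R h i)" for x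
  note hom = emb[unfolded embedding_map_def]
  have cont: "continuous_map (top_of_set (\<Union>X)) (Euclidean_space d) f"
    using homeomorphic_imp_continuous_map[OF hom] by (simp add: continuous_map_in_subtopology)
  have inj: "inj_on f (\<Union>X)"
    using homeomorphic_imp_injective_map[OF hom] by simp
  have comp: "continuous_on (\<Union>X) (\<lambda>x. f x i)" for i
    using cont by (simp add: Euclidean_space_def continuous_map_in_subtopology
        continuous_map_componentwise_UNIV)
  have zero: "f x i = 0" if "x \<in> \<Union>X" "i \<ge> d" for x i
    using continuous_map_image_subset_topspace[OF cont] that by (auto simp: topspace_Euclidean_space)
  have FX: "F \<subseteq> \<Union>X" using F by blast
  have "aff_dim F \<le> aff_dim (span D)"
  proof (rule invariance_of_dimension_convex_domain)
    show "convex F" using X F by (simp add: polyhedral_complex_def polytope_imp_convex)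
    show "continuous_on F g"
      unfolding g_def by (intro continuous_intros continuous_on_subset[OF comp FX])
    show "g \<in> F \<rightarrow> affine hull span D"
    proof
      fix x
      have "g x \<in> span D" unfolding g_def
        using h by (intro span_sum span_scale span_base) (auto simp: bij_betw_def)
      then show "g x \<in> affine hull span D" by (rule hull_inc)
    qed
    have gcoord: "g x \<bullet> h j = f x j" if "j < d" for x j
    proof -
      have "h i \<bullet> h j = (if i = j then 1 else 0)" if "i < d" for i
      proof -
        have "h i \<in> Basis" "h j \<in> Basis" "h i = h j \<longleftrightarrow> i = j"
          using bij_betwE[OF h] D(1) bij_betw_imp_inj_on[OF h] that \<open>j < d\<close>
          by (auto dest: inj_onD)
        then show ?thesis by (simp add: inner_Basis)
      qed
      then have "g x \<bullet> h j = (\<Sum>i<d. if i = j then f x i else 0)"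
        unfolding g_def inner_sum_left by (intro sum.cong) auto
      then show ?thesis using that by simp
    qed
    show "inj_on g F"
    proof (rule inj_onI)
      fix x y assume xy: "x \<in> F" "y \<in> F" "g x = g y"
      have XX: "x \<in> \<Union>X" "y \<in> \<Union>X" using xy FX by blast+
      have "f x j = f y j" for j
        using gcoord[of j x] gcoord[of j y] zero[OF XX(1), of j] zero[OF XX(2), of j] xy(3)
        by (cases "j < d") simp_all
      then have "f x = f y" by blast
      then show "x = y" by (rule inj_onD[OF inj _ XX])
    qed
  qed
  also have "\<dots> \<le> int d"
    using D finD by (simp add: aff_dim_subspace subspace_span dim_span) (metis dim_le_card')
  finally show ?thesis .
qed

section \<open>Primes generated by variables\<close>

lemma poly_ring_simps:
  "mult (poly_ring B) = (*)" "one (poly_ring B) = 1" "zero (poly_ring B) = 0" "add (poly_ring B) = (+)"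
  by (simp_all add: poly_ring_def)

lemma in_carrier_poly_ring_iff:
  "p \<in> carrier (poly_ring B) \<longleftrightarrow> (\<forall>m\<in>Poly_Mapping.keys p. Poly_Mapping.keys m \<subseteq> B)"
  by (simp add: poly_ring_def)

lemma keys_add_expo: "Poly_Mapping.keys (m + m' :: 'b expo) = Poly_Mapping.keys m \<union> Poly_Mapping.keys m'"
  by (auto simp: in_keys_iff lookup_add)

lemma lookup_mult_eq_0:
  fixes p q :: "('b, 'k::field) mpol"
  assumes "\<And>s t. s \<in> Poly_Mapping.keys p \<Longrightarrow> t \<in> Poly_Mapping.keys q \<Longrightarrow> s + t \<noteq> k"
  shows "Poly_Mapping.lookup (p * q) k = 0"
proof (rule ccontr)
  assume "Poly_Mapping.lookup (p * q) k \<noteq> 0"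
  then have "k \<in> Poly_Mapping.keys (p * q)" by (simp add: in_keys_iff)
  from subsetD[OF keys_mult this] assms show False by blast
qed

lemma lookup_mult_unique:
  fixes p q :: "('b, 'k::field) mpol"
  assumes uniq: "\<And>s t. s \<in> Poly_Mapping.keys p \<Longrightarrow> t \<in> Poly_Mapping.keys q \<Longrightarrow> s + t = m + n \<Longrightarrow> s = m \<and> t = n"
  shows "Poly_Mapping.lookup (p * q) (m + n) = Poly_Mapping.lookup p m * Poly_Mapping.lookup q n"
proof -
  define p' where "p' = p - Poly_Mapping.single m (Poly_Mapping.lookup p m)"
  define q' where "q' = q - Poly_Mapping.single n (Poly_Mapping.lookup q n)"
  have p': "Poly_Mapping.keys p' \<subseteq> Poly_Mapping.keys p - {m}"
    by (auto simp: p'_def in_keys_iff lookup_minus lookup_single when_def split: if_splits)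
  have q': "Poly_Mapping.keys q' \<subseteq> Poly_Mapping.keys q - {n}"
    by (auto simp: q'_def in_keys_iff lookup_minus lookup_single when_def split: if_splits)
  have 1: "Poly_Mapping.lookup (p' * q) (m + n) = 0"
    using p' uniq by (intro lookup_mult_eq_0) blast
  have 2: "Poly_Mapping.lookup (Poly_Mapping.single m (Poly_Mapping.lookup p m) * q') (m + n) = 0"
    using q' by (intro lookup_mult_eq_0) (auto split: if_splits)
  have "p * q = p' * q + Poly_Mapping.single m (Poly_Mapping.lookup p m) * q'
      + Poly_Mapping.single m (Poly_Mapping.lookup p m) * Poly_Mapping.single n (Poly_Mapping.lookup q n)"
    by (simp add: p'_def q'_def algebra_simps)
  then show ?thesis by (simp add: lookup_add 1 2 mult_single)
qed

text \<open>The set of variables carries no order, so there is no term order on its monomials at hand. Numbering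
the finitely many variables in \<open>B\<close> embeds their exponent vectors additively into exponent vectors
over \<^typ>\<open>nat\<close>, which are linearly ordered compatibly with addition.\<close>

lemma additive_embedding_into_ordered_exponents:
  assumes "finite B"
  shows "\<exists>w :: 'b expo \<Rightarrow> nat expo. (\<forall>m n. w (m + n) = w m + w n) \<and>
           inj_on w {m. Poly_Mapping.keys m \<subseteq> B}"
proof -
  obtain g :: "'b \<Rightarrow> nat" where g: "inj_on g B"
    using assms finite_imp_inj_to_nat_seg by metis
  define w :: "'b expo \<Rightarrow> nat expo" where
    "w m = (\<Sum>i\<in>B. Poly_Mapping.single (g i) (Poly_Mapping.lookup m i))" for m
  have add: "w (m + n) = w m + w n" for m n
    by (simp add: w_def lookup_add single_add sum.distrib)
  have coord: "Poly_Mapping.lookup (w m) (g i) = Poly_Mapping.lookup m i" if "i \<in> B" for m i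
  proof -
    have "Poly_Mapping.lookup (w m) (g i) = (\<Sum>j\<in>B. if j = i then Poly_Mapping.lookup m j else 0)"
      unfolding w_def lookup_sum lookup_single when_def
      using g that by (intro sum.cong) (auto dest: inj_onD)
    then show ?thesis using assms that by simp
  qed
  have "inj_on w {m. Poly_Mapping.keys m \<subseteq> B}"
  proof (rule inj_onI)
    fix m n assume mn: "m \<in> {m. Poly_Mapping.keys m \<subseteq> B}" "n \<in> {m. Poly_Mapping.keys m \<subseteq> B}" "w m = w n"
    show "m = n"
    proof (rule poly_mapping_eqI)
      fix i
      show "Poly_Mapping.lookup m i = Poly_Mapping.lookup n i"
      proof (cases "i \<in> B")
        case True
        then show ?thesis using coord[of i m] coord[of i n] mn by simp
      next
        case False
        then have "i \<notin> Poly_Mapping.keys m" "i \<notin> Poly_Mapping.keys n" using mn by auto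
        then show ?thesis by (simp add: in_keys_iff)
      qed
    qed
  qed
  with add show ?thesis by blast
qed

text \<open>The ideal generated by the variables in \<open>T \<inter> B\<close>, described by its monomials so that membership is
a condition on supports.\<close>

definition variable_prime :: "'b set \<Rightarrow> 'b set \<Rightarrow> ('b, 'k::field) mpol set" where
  "variable_prime B T =
     {p \<in> carrier (poly_ring B). \<forall>m\<in>Poly_Mapping.keys p. Poly_Mapping.keys m \<inter> T \<noteq> {}}"

text \<open>If \<open>p\<close> and \<open>q\<close> both have monomials free of the variables in \<open>T\<close>, the largest such monomials in a
term order have a product that is again free of \<open>T\<close> and that arises in \<open>p * q\<close> in only one way,
hence occurs there with nonzero coefficient.\<close>

lemma primeideal_variable_prime:
  assumes "finite B"
  shows "primeideal (variable_prime B T :: ('b, 'k::field) mpol set) (poly_ring B)"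
proof -
  let ?P = "variable_prime B T :: ('b, 'k) mpol set" and ?R = "poly_ring B :: ('b, 'k) mpol ring"
  interpret R: cring ?R by (rule cring_poly_ring)
  have sub: "subgroup ?P (add_monoid ?R)"
  proof (rule R.add.subgroupI)
    show "?P \<subseteq> carrier ?R" by (auto simp: variable_prime_def)
    have "0 \<in> ?P" by (simp add: variable_prime_def in_carrier_poly_ring_iff)
    then show "?P \<noteq> {}" by blast
    fix p q assume pq: "p \<in> ?P"
    have "\<ominus>\<^bsub>?R\<^esub> p = - p"
      using pq by (intro R.minus_equality) (auto simp: variable_prime_def in_carrier_poly_ring_iff poly_ring_simps)
    then show "\<ominus>\<^bsub>?R\<^esub> p \<in> ?P" using pq by (simp add: variable_prime_def in_carrier_poly_ring_iff)
    assume "q \<in> ?P"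
    with pq show "p \<oplus>\<^bsub>?R\<^esub> q \<in> ?P"
      unfolding variable_prime_def in_carrier_poly_ring_iff poly_ring_simps
      using subsetD[OF keys_add[of p q]] by blast
  qed
  have absorb: "x * a \<in> ?P" if a: "a \<in> ?P" and x: "x \<in> carrier ?R" for a x
  proof -
    have "a \<in> carrier ?R" using a by (simp add: variable_prime_def)
    then have "x * a \<in> carrier ?R"
      using R.m_closed[OF x] by (simp add: poly_ring_simps)
    moreover have "Poly_Mapping.keys m \<inter> T \<noteq> {}" if mem: "m \<in> Poly_Mapping.keys (x * a)" for m
    proof -
      obtain s t where st: "m = s + t" "t \<in> Poly_Mapping.keys a"
        using subsetD[OF keys_mult[of x a] mem] by blast
      then have "Poly_Mapping.keys t \<inter> T \<noteq> {}" using a by (simp add: variable_prime_def)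
      then show ?thesis unfolding st(1) keys_add_expo by blast
    qed
    ultimately show ?thesis by (simp add: variable_prime_def)
  qed
  show ?thesis
  proof (rule primeidealI[OF idealI])
    show "ring ?R" "cring ?R" by (rule R.ring_axioms, rule R.is_cring)
    show "subgroup ?P (add_monoid ?R)" by (rule sub)
    show "x \<otimes>\<^bsub>?R\<^esub> a \<in> ?P" "a \<otimes>\<^bsub>?R\<^esub> x \<in> ?P" if "a \<in> ?P" "x \<in> carrier ?R" for a x
      using absorb[OF that] by (simp_all add: poly_ring_simps mult.commute)
    have "1 \<in> carrier ?R" "1 \<notin> ?P" by (auto simp: variable_prime_def in_carrier_poly_ring_iff)
    then show "carrier ?R \<noteq> ?P" by blast
    fix p q assume p: "p \<in> carrier ?R" and q: "q \<in> carrier ?R" and pq: "p \<otimes>\<^bsub>?R\<^esub> q \<in> ?P"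
    obtain w :: "'b expo \<Rightarrow> nat expo" where add: "\<And>m n. w (m + n) = w m + w n"
      and inj: "inj_on w {m. Poly_Mapping.keys m \<subseteq> B}"
      using additive_embedding_into_ordered_exponents[OF assms] by blast
    define K where "K r = {m \<in> Poly_Mapping.keys r. Poly_Mapping.keys m \<inter> T = {}}" for r :: "('b, 'k) mpol"
    have top: "\<exists>m\<in>K r. \<forall>n\<in>K r. w n \<le> w m" if "r \<in> carrier ?R" "r \<notin> ?P" for r
    proof -
      have "finite (w ` K r)" "w ` K r \<noteq> {}"
        using that by (auto simp: K_def variable_prime_def)
      then have "Max (w ` K r) \<in> w ` K r" "\<And>n. n \<in> K r \<Longrightarrow> w n \<le> Max (w ` K r)"
        by (auto intro: Max_in Max_ge)
      then show ?thesis by (metis imageE)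
    qed
    show "p \<in> ?P \<or> q \<in> ?P"
    proof (rule ccontr)
      assume "\<not> ?thesis"
      then obtain m n where m: "m \<in> K p" "\<And>s. s \<in> K p \<Longrightarrow> w s \<le> w m"
        and n: "n \<in> K q" "\<And>t. t \<in> K q \<Longrightarrow> w t \<le> w n"
        using top[OF p] top[OF q] by blast
      have "Poly_Mapping.lookup (p * q) (m + n) = Poly_Mapping.lookup p m * Poly_Mapping.lookup q n"
      proof (rule lookup_mult_unique)
        fix s t assume st: "s \<in> Poly_Mapping.keys p" "t \<in> Poly_Mapping.keys q" "s + t = m + n"
        have "Poly_Mapping.keys s \<union> Poly_Mapping.keys t = Poly_Mapping.keys m \<union> Poly_Mapping.keys n"
          using st(3) by (metis keys_add_expo)
        then have "s \<in> K p" "t \<in> K q" using st m n by (auto simp: K_def)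
        then have le: "w s \<le> w m" "w t \<le> w n" using m n by blast+
        have eq: "w s + w t = w m + w n" using st(3) add by metis
        have "w s = w m"
          using le eq add_less_le_mono[of "w s" "w m" "w t" "w n"] by (metis order.strict_iff_order less_irrefl)
        moreover from this eq have "w t = w n" by simp
        ultimately show "s = m \<and> t = n"
          using inj st m n p q unfolding in_carrier_poly_ring_iff K_def inj_on_def by blast
      qed
      also have "\<dots> \<noteq> 0" using m n by (simp add: K_def in_keys_iff)
      finally have "m + n \<in> Poly_Mapping.keys (p * q)" by (simp add: in_keys_iff)
      then have "Poly_Mapping.keys (m + n) \<inter> T \<noteq> {}"
        using pq by (simp add: variable_prime_def poly_ring_simps)
      then show False using m n by (auto simp: keys_add_expo K_def)
    qed
  qed
qed

section \<open>Chains of primes in polynomial rings\<close>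

text \<open>Linear independence over the coefficient field in the quotient by \<open>Q\<close>; a scalar \<open>c\<close> is the constant
polynomial \<open>single 0 c\<close>.\<close>

definition independent_mod :: "('b, 'k::field) mpol set \<Rightarrow> 'l set \<Rightarrow> ('l \<Rightarrow> ('b, 'k) mpol) \<Rightarrow> bool" where
  "independent_mod Q L u \<longleftrightarrow>
     (\<forall>c. (\<Sum>l\<in>L. Poly_Mapping.single 0 (c l) * u l) \<in> Q \<longrightarrow> (\<forall>l\<in>L. c l = 0))"

fun power_product :: "(nat \<Rightarrow> 'p::comm_monoid_mult) \<Rightarrow> nat list \<Rightarrow> 'p" where
  "power_product f [] = 1"
| "power_product f (e # l) = f 0 ^ e * power_product (\<lambda>i. f (Suc i)) l"

definition exponent_box :: "nat \<Rightarrow> nat \<Rightarrow> nat list set" where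
  "exponent_box n M = {l. set l \<subseteq> {..M} \<and> length l = n}"

lemma finite_exponent_box: "finite (exponent_box n M)"
  unfolding exponent_box_def by (rule finite_lists_length_eq) simp

lemma card_exponent_box: "card (exponent_box n M) = Suc M ^ n"
  unfolding exponent_box_def by (simp add: card_lists_length_eq)

lemma sum_exponent_box_Suc:
  "(\<Sum>l\<in>exponent_box (Suc n) M. h l) = (\<Sum>e\<le>M. \<Sum>l\<in>exponent_box n M. h (e # l))"
proof -
  have "exponent_box (Suc n) M = (\<lambda>(e, l). e # l) ` ({..M} \<times> exponent_box n M)"
    by (auto simp: exponent_box_def length_Suc_conv image_iff)
  moreover have "inj_on (\<lambda>(e, l). e # l) ({..M} \<times> exponent_box n M)"
    by (auto simp: inj_on_def)
  ultimately show ?thesis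
    by (simp add: sum.reindex sum.cartesian_product comp_def case_prod_unfold)
qed

lemma
  fixes p q :: "('b, 'k::field) mpol"
  assumes "p \<in> carrier (poly_ring B)" "q \<in> carrier (poly_ring B)"
  shows carrier_mult: "p * q \<in> carrier (poly_ring B)"
    and carrier_add: "p + q \<in> carrier (poly_ring B)"
proof -
  interpret cring "poly_ring B :: ('b, 'k) mpol ring" by (rule cring_poly_ring)
  show "p * q \<in> carrier (poly_ring B)" "p + q \<in> carrier (poly_ring B)"
    using m_closed[OF assms] add.m_closed[OF assms] by (simp_all add: poly_ring_simps)
qed

lemma carrier_scalar: "Poly_Mapping.single 0 c \<in> carrier (poly_ring B)"
  by (simp add: in_carrier_poly_ring_iff)

lemma carrier_one: "1 \<in> carrier (poly_ring B)"
  by (simp add: in_carrier_poly_ring_iff)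

lemma carrier_zero: "0 \<in> carrier (poly_ring B)"
  by (simp add: in_carrier_poly_ring_iff)

lemma carrier_power: "p \<in> carrier (poly_ring B) \<Longrightarrow> p ^ n \<in> carrier (poly_ring B)"
  for p :: "('b, 'k::field) mpol"
  by (induction n) (auto intro: carrier_mult carrier_one)

lemma carrier_sum: "(\<And>l. l \<in> L \<Longrightarrow> u l \<in> carrier (poly_ring B)) \<Longrightarrow> sum u L \<in> carrier (poly_ring B)"
  for u :: "'l \<Rightarrow> ('b, 'k::field) mpol"
  by (induction L rule: infinite_finite_induct) (auto intro: carrier_add carrier_zero)

lemma carrier_power_product:
  fixes f :: "nat \<Rightarrow> ('b, 'k::field) mpol"
  assumes "\<And>i. i < length l \<Longrightarrow> f i \<in> carrier (poly_ring B)"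
  shows "power_product f l \<in> carrier (poly_ring B)"
  using assms
proof (induction l arbitrary: f)
  case (Cons e l)
  have "power_product (\<lambda>i. f (Suc i)) l \<in> carrier (poly_ring B)"
    using Cons.prems by (intro Cons.IH) auto
  moreover have "f 0 \<in> carrier (poly_ring B)" using Cons.prems by simp
  ultimately show ?case by (simp add: carrier_mult carrier_power)
qed (simp add: carrier_one)

lemma primeideal_poly_ringD:
  fixes Q :: "('b, 'k::field) mpol set"
  assumes "primeideal Q (poly_ring B)"
  shows "Q \<subseteq> carrier (poly_ring B)" "0 \<in> Q" "1 \<notin> Q"
    "p \<in> Q \<Longrightarrow> q \<in> Q \<Longrightarrow> p + q \<in> Q" "p \<in> Q \<Longrightarrow> q \<in> Q \<Longrightarrow> p - q \<in> Q"
    "p \<in> Q \<Longrightarrow> r \<in> carrier (poly_ring B) \<Longrightarrow> r * p \<in> Q"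
    "p \<in> carrier (poly_ring B) \<Longrightarrow> r \<in> carrier (poly_ring B) \<Longrightarrow> p * r \<in> Q \<Longrightarrow> p \<in> Q \<or> r \<in> Q"
proof -
  interpret primeideal Q "poly_ring B" by fact
  show "Q \<subseteq> carrier (poly_ring B)" by (rule a_subset)
  show "0 \<in> Q" using additive_subgroup.zero_closed[OF additive_subgroup_axioms] by (simp add: poly_ring_simps)
  show "1 \<notin> Q" using one_imp_carrier I_notcarr by (auto simp: poly_ring_simps)
  show sum: "p + q \<in> Q" if "p \<in> Q" "q \<in> Q" for p q
    using additive_subgroup.a_closed[OF additive_subgroup_axioms that] by (simp add: poly_ring_simps)
  show mul: "r * p \<in> Q" if "p \<in> Q" "r \<in> carrier (poly_ring B)" for r p
    using I_l_closed[OF that] by (simp add: poly_ring_simps)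
  show "p - q \<in> Q" if "p \<in> Q" "q \<in> Q"
    using sum[OF that(1) mul[OF that(2) carrier_scalar[of "-1"]]]
    by (simp add: single_uminus)
  show "p \<in> carrier (poly_ring B) \<Longrightarrow> r \<in> carrier (poly_ring B) \<Longrightarrow> p * r \<in> Q \<Longrightarrow> p \<in> Q \<or> r \<in> Q"
    using I_prime[of p r] by (simp add: poly_ring_simps)
qed

text \<open>Modulo \<open>Q'\<close> only the term with \<open>e = 0\<close> survives, as \<open>f \<in> Q'\<close>; so \<open>w 0\<close> vanishes. What remains of
the relation is divisible by \<open>f\<close>, which can be cancelled modulo the prime \<open>Q\<close> since \<open>f \<notin> Q\<close>.\<close>

lemma coefficients_zero_of_power_relation:
  fixes Q Q' :: "('b, 'k::field) mpol set"
  assumes Q: "primeideal Q (poly_ring B)" and Q': "primeideal Q' (poly_ring B)"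
    and sub: "Q \<subseteq> Q'" and f: "f \<in> Q'" "f \<notin> Q"
    and w: "\<And>e. e \<le> M \<Longrightarrow> w e \<in> carrier (poly_ring B)" "\<And>e. e \<le> M \<Longrightarrow> w e \<in> Q' \<Longrightarrow> w e = 0"
    and rel: "(\<Sum>e\<le>M. f ^ e * w e) \<in> Q"
  shows "\<forall>e\<le>M. w e = 0"
  using w rel
proof (induction M arbitrary: w)
  case 0
  then show ?case using sub by auto
next
  case (Suc M)
  note q = primeideal_poly_ringD[OF Q] and q' = primeideal_poly_ringD[OF Q']
  have fc: "f \<in> carrier (poly_ring B)" using f q' by blast
  define S where "S = (\<Sum>e\<le>M. f ^ e * w (Suc e))"
  have S: "S \<in> carrier (poly_ring B)"
    unfolding S_def by (intro carrier_sum carrier_mult carrier_power fc Suc.prems) simp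
  have split: "(\<Sum>e\<le>Suc M. f ^ e * w e) = w 0 + S * f"
    by (simp add: sum.atMost_Suc_shift S_def sum_distrib_left mult_ac del: sum.atMost_Suc)
  have "w 0 + S * f \<in> Q'" using Suc.prems(3) sub split by auto
  then have "w 0 + S * f - S * f \<in> Q'" using q'(5) q'(6)[OF f(1) S] by blast
  then have w0: "w 0 = 0" using Suc.prems(2)[of 0] by simp
  then have "S * f \<in> Q" using Suc.prems(3) split by simp
  then have "S \<in> Q" using q(7)[OF S fc] f by blast
  then have "\<forall>e\<le>M. w (Suc e) = 0"
    unfolding S_def using Suc.prems by (intro Suc.IH) auto
  with w0 show ?case by (metis Suc_le_mono not0_implies_Suc)
qed

text \<open>By induction along the chain: a relation modulo \<open>Q 0\<close>, sorted by powers of \<open>f 0\<close>, has as coefficients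
combinations of power products of the later \<open>f i\<close>, which are independent modulo \<open>Q 1\<close>. So the \<open>f i\<close>
are algebraically independent over the field, even modulo \<open>Q 0\<close>.\<close>

lemma power_products_independent_mod:
  fixes Q :: "nat \<Rightarrow> ('b, 'k::field) mpol set"
  assumes "\<And>i. i \<le> n \<Longrightarrow> primeideal (Q i) (poly_ring B)"
    and "\<And>i. i < n \<Longrightarrow> Q i \<subseteq> Q (Suc i) \<and> f i \<in> Q (Suc i) - Q i"
  shows "independent_mod (Q 0) (exponent_box n M) (power_product f)"
  using assms
proof (induction n arbitrary: Q f)
  case 0
  note q = primeideal_poly_ringD[OF 0(1)[of 0, simplified]]
  have "c = 0" if "Poly_Mapping.single 0 c \<in> Q 0" for c
  proof (rule ccontr)
    assume "c \<noteq> 0"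
    then have "1 = Poly_Mapping.single 0 (inverse c) * (Poly_Mapping.single 0 c :: ('b, 'k) mpol)"
      by (simp add: mult_single)
    with q(6)[OF that carrier_scalar[of "inverse c"]] q(3) show False by simp
  qed
  moreover have "exponent_box 0 M = {[]}" by (auto simp: exponent_box_def)
  ultimately show ?case by (simp add: independent_mod_def)
next
  case (Suc n)
  have IH: "independent_mod (Q 1) (exponent_box n M) (power_product (\<lambda>i. f (Suc i)))"
    using Suc.IH[of "\<lambda>i. Q (Suc i)" "\<lambda>i. f (Suc i)"] Suc.prems by simp
  have P0: "primeideal (Q 0) (poly_ring B)" and P1: "primeideal (Q 1) (poly_ring B)"
    and sub: "Q 0 \<subseteq> Q 1" and f0: "f 0 \<in> Q 1" "f 0 \<notin> Q 0"
    using Suc.prems(1)[of 0] Suc.prems(1)[of 1] Suc.prems(2)[of 0] by auto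
  have fc: "f i \<in> carrier (poly_ring B)" if "i < Suc n" for i
    using Suc.prems(2)[OF that] primeideal_poly_ringD(1)[OF Suc.prems(1)[of "Suc i"]] that by auto
  show ?case
    unfolding independent_mod_def
  proof (intro allI impI ballI)
    fix c l assume rel: "(\<Sum>l\<in>exponent_box (Suc n) M. Poly_Mapping.single 0 (c l) * power_product f l) \<in> Q 0"
      and l: "l \<in> exponent_box (Suc n) M"
    define w where "w e = (\<Sum>l\<in>exponent_box n M.
      Poly_Mapping.single 0 (c (e # l)) * power_product (\<lambda>i. f (Suc i)) l)" for e
    have w1: "\<forall>l\<in>exponent_box n M. c (e # l) = 0" if "w e \<in> Q 1" for e
      using IH that unfolding independent_mod_def w_def by (elim allE impE) auto
    have "\<forall>e\<le>M. w e = 0"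
    proof (rule coefficients_zero_of_power_relation[OF P0 P1 sub f0])
      show "w e \<in> carrier (poly_ring B)" for e
        unfolding w_def using fc
        by (intro carrier_sum carrier_mult carrier_scalar carrier_power_product)
          (auto simp: exponent_box_def)
      show "w e = 0" if "w e \<in> Q 1" for e
        using w1[OF that] by (simp add: w_def)
      show "(\<Sum>e\<le>M. f 0 ^ e * w e) \<in> Q 0"
        using rel by (simp add: sum_exponent_box_Suc w_def sum_distrib_left mult_ac)
    qed
    moreover obtain e l' where "l = e # l'" "e \<le> M" "l' \<in> exponent_box n M"
      using l by (auto simp: exponent_box_def length_Suc_conv)
    ultimately show "c l = 0"
      using w1[of e] primeideal_poly_ringD(2)[OF P1] by auto
  qed
qed

definition exponents_le :: "nat \<Rightarrow> ('b, 'k::field) mpol \<Rightarrow> bool" where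
  "exponents_le N p \<longleftrightarrow> (\<forall>m\<in>Poly_Mapping.keys p. \<forall>i. Poly_Mapping.lookup m i \<le> N)"

lemma exponents_le_mult: "exponents_le M p \<Longrightarrow> exponents_le N q \<Longrightarrow> exponents_le (M + N) (p * q)"
  unfolding exponents_le_def
proof (intro ballI allI)
  fix m i assume p: "\<forall>m\<in>Poly_Mapping.keys p. \<forall>i. Poly_Mapping.lookup m i \<le> M"
    and q: "\<forall>m\<in>Poly_Mapping.keys q. \<forall>i. Poly_Mapping.lookup m i \<le> N"
    and m: "m \<in> Poly_Mapping.keys (p * q)"
  obtain s t where "m = s + t" "s \<in> Poly_Mapping.keys p" "t \<in> Poly_Mapping.keys q"
    using subsetD[OF keys_mult m] by blast
  then show "Poly_Mapping.lookup m i \<le> M + N" using p q by (simp add: lookup_add add_mono)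
qed

lemma exponents_le_power: "exponents_le N p \<Longrightarrow> exponents_le (e * N) (p ^ e)"
  by (induction e) (auto intro: exponents_le_mult simp: exponents_le_def[of 0])

lemma exponents_le_mono: "exponents_le M p \<Longrightarrow> M \<le> N \<Longrightarrow> exponents_le N p"
  unfolding exponents_le_def using le_trans by blast

lemma ex_exponents_le: "\<exists>N. exponents_le N p"
proof -
  define K where "K = (\<Union>m\<in>Poly_Mapping.keys p. Poly_Mapping.lookup m ` Poly_Mapping.keys m)"
  have fin: "finite K" by (simp add: K_def)
  have "Poly_Mapping.lookup m i \<le> Max (insert 0 K)" if "m \<in> Poly_Mapping.keys p" for m i
  proof (cases "i \<in> Poly_Mapping.keys m")
    case True
    then have "Poly_Mapping.lookup m i \<in> K" using that by (auto simp: K_def)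
    then show ?thesis using fin by (intro Max_ge) auto
  qed (simp add: in_keys_iff)
  then show ?thesis unfolding exponents_le_def by blast
qed

lemma exponents_le_power_product:
  fixes f :: "nat \<Rightarrow> ('b, 'k::field) mpol"
  assumes "\<And>i. i < n \<Longrightarrow> exponents_le D (f i)" "l \<in> exponent_box n M"
  shows "exponents_le (n * M * D) (power_product f l)"
  using assms
proof (induction n arbitrary: l f)
  case 0
  then show ?case by (simp add: exponent_box_def exponents_le_def)
next
  case (Suc n)
  obtain e l' where l: "l = e # l'" "e \<le> M" "l' \<in> exponent_box n M"
    using Suc.prems(2) by (auto simp: exponent_box_def length_Suc_conv)
  have "exponents_le (M * D) (f 0 ^ e)"
    using exponents_le_power[OF Suc.prems(1)[of 0], of e] l(2) by (auto elim!: exponents_le_mono)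
  moreover have "exponents_le (n * M * D) (power_product (\<lambda>i. f (Suc i)) l')"
    using Suc.prems(1) l(3) by (intro Suc.IH) auto
  ultimately show ?case
    using exponents_le_mult by (fastforce simp: l(1) algebra_simps)
qed

lemma card_bounded_exponents:
  fixes N :: nat
  assumes "finite B"
  defines "E \<equiv> {m :: 'b expo. Poly_Mapping.keys m \<subseteq> B \<and> (\<forall>i. Poly_Mapping.lookup m i \<le> N)}"
  shows "finite E" "card E \<le> Suc N ^ card B"
proof -
  have fin: "finite (B \<rightarrow>\<^sub>E {..N})" using assms by (intro finite_PiE) auto
  have sub: "(\<lambda>m. restrict (Poly_Mapping.lookup m) B) ` E \<subseteq> B \<rightarrow>\<^sub>E {..N}"
    by (auto simp: E_def)
  have inj: "inj_on (\<lambda>m. restrict (Poly_Mapping.lookup m) B) E"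
  proof (rule inj_onI)
    fix m n assume m: "m \<in> E" and n: "n \<in> E"
      and eq: "restrict (Poly_Mapping.lookup m) B = restrict (Poly_Mapping.lookup n) B"
    show "m = n"
    proof (rule poly_mapping_eqI)
      fix i
      show "Poly_Mapping.lookup m i = Poly_Mapping.lookup n i"
      proof (cases "i \<in> B")
        case True
        then show ?thesis using fun_cong[OF eq, of i] by simp
      next
        case False
        then have "i \<notin> Poly_Mapping.keys m" "i \<notin> Poly_Mapping.keys n" using m n by (auto simp: E_def)
        then show ?thesis by (simp add: in_keys_iff)
      qed
    qed
  qed
  show "finite E" by (rule inj_on_finite[OF inj sub fin])
  have "card E \<le> card (B \<rightarrow>\<^sub>E {..N})" by (rule card_inj_on_le[OF inj sub fin])
  also have "\<dots> = Suc N ^ card B" using assms by (simp add: card_PiE)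
  finally show "card E \<le> Suc N ^ card B" .
qed

text \<open>The polynomials in the variables \<open>B\<close> all of whose exponents are at most \<open>N\<close> form a vector space
spanned by \<open>(N + 1) ^ card B\<close> monomials.\<close>

lemma card_independent_le:
  fixes u :: "'l \<Rightarrow> ('b, 'k::field) mpol"
  assumes "finite B" "finite L" and Q: "0 \<in> Q" and ind: "independent_mod Q L u"
    and u: "\<And>l. l \<in> L \<Longrightarrow> u l \<in> carrier (poly_ring B)" "\<And>l. l \<in> L \<Longrightarrow> exponents_le N (u l)"
  shows "card L \<le> Suc N ^ card B"
proof -
  interpret V: vector_space "\<lambda>c p. Poly_Mapping.single 0 c * (p :: ('b, 'k) mpol)"
    by unfold_locales (auto simp: algebra_simps single_add mult_single simp flip: mult.assoc)
  define E where "E = {m :: 'b expo. Poly_Mapping.keys m \<subseteq> B \<and> (\<forall>i. Poly_Mapping.lookup m i \<le> N)}"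
  have E: "finite E" "card E \<le> Suc N ^ card B"
    unfolding E_def by (rule card_bounded_exponents[OF assms(1)])+
  have inj: "inj_on u L"
  proof (rule inj_onI, rule ccontr)
    fix k l assume kl: "k \<in> L" "l \<in> L" "u k = u l" "k \<noteq> l"
    define c :: "'l \<Rightarrow> 'k" where "c i = (if i = k then 1 else if i = l then -1 else 0)" for i
    have "(\<Sum>i\<in>L. Poly_Mapping.single 0 (c i) * u i) = (\<Sum>i\<in>{k, l}. Poly_Mapping.single 0 (c i) * u i)"
      using kl assms(2) by (intro sum.mono_neutral_right) (auto simp: c_def)
    also have "\<dots> = 0" using kl by (simp add: c_def single_uminus)
    finally have "c k = 0" using ind Q kl(1) unfolding independent_mod_def by auto
    then show False by (simp add: c_def)
  qed
  have "V.independent (u ` L)"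
  proof (rule V.independent_if_scalars_zero)
    show "finite (u ` L)" using assms(2) by simp
    fix g x assume rel: "(\<Sum>x\<in>u ` L. Poly_Mapping.single 0 (g x) * x) = 0" and "x \<in> u ` L"
    then obtain l where l: "l \<in> L" "x = u l" by blast
    have "(\<Sum>l\<in>L. Poly_Mapping.single 0 (g (u l)) * u l) = 0"
      using rel by (simp add: sum.reindex[OF inj])
    then have "(\<Sum>l\<in>L. Poly_Mapping.single 0 ((g \<circ> u) l) * u l) \<in> Q" using Q by simp
    then have "(g \<circ> u) l = 0" using ind l(1) unfolding independent_mod_def by blast
    then show "g x = 0" using l by simp
  qed
  moreover have "u ` L \<subseteq> V.span (monomial ` E)"
  proof
    fix p assume "p \<in> u ` L"
    then have p: "Poly_Mapping.keys p \<subseteq> E"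
      using u by (auto simp: E_def in_carrier_poly_ring_iff exponents_le_def)
    have "p = (\<Sum>m\<in>Poly_Mapping.keys p. Poly_Mapping.single 0 (Poly_Mapping.lookup p m) * monomial m)"
      by (rule poly_mapping_eqI)
        (simp add: monomial_def mult_single lookup_sum lookup_single when_def in_keys_iff)
    moreover have "\<dots> \<in> V.span (monomial ` E)"
      using p by (intro V.span_sum V.span_scale V.span_base) auto
    ultimately show "p \<in> V.span (monomial ` E)" by simp
  qed
  ultimately have "card (u ` L) \<le> card (monomial ` E :: ('b, 'k) mpol set)"
    using V.independent_span_bound[of "monomial ` E" "u ` L"] E(1) by blast
  also have "\<dots> \<le> card E" by (rule card_image_le[OF E(1)])
  finally show ?thesis using E(2) by (simp add: card_image[OF inj])
qed

lemma le_if_powers_dominated: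
  fixes b n K :: nat
  assumes "\<And>M. Suc M ^ n \<le> (K * Suc M) ^ b"
  shows "n \<le> b"
proof (rule ccontr)
  assume "\<not> ?thesis"
  then have "Suc b \<le> n" by simp
  \<comment> \<open>For this M the leading factor Suc M of the left-hand side exceeds the constant on the right.\<close>
  define M where "M = K ^ b"
  have "Suc M * Suc M ^ b = Suc M ^ Suc b" by simp
  also have "\<dots> \<le> Suc M ^ n" using \<open>Suc b \<le> n\<close> by (intro power_increasing) auto
  also have "\<dots> \<le> (K * Suc M) ^ b" by (rule assms)
  also have "\<dots> = M * Suc M ^ b" by (simp only: M_def power_mult_distrib)
  finally show False by simp
qed

text \<open>A chain of length \<open>n\<close>
yields \<open>n\<close> algebraically independent polynomials \<open>f i\<close>. Their \<open>(M + 1) ^ n\<close> power products with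
exponents at most \<open>M\<close> only involve monomials whose exponents are bounded by a constant times
\<open>M + 1\<close>, of which there are \<open>O(M ^ card B)\<close>. Letting \<open>M\<close> grow gives \<open>n \<le> card B\<close>.\<close>

lemma prime_chain_length_le_card:
  fixes Q :: "nat \<Rightarrow> ('b, 'k::field) mpol set"
  assumes "finite B"
    and prime: "\<And>i. i \<le> n \<Longrightarrow> primeideal (Q i) (poly_ring B)"
    and strict: "\<And>i. i < n \<Longrightarrow> Q i \<subset> Q (Suc i)"
  shows "n \<le> card B"
proof -
  have "\<forall>i. \<exists>f. i < n \<longrightarrow> f \<in> Q (Suc i) - Q i" using strict by blast
  then obtain f where f: "\<And>i. i < n \<Longrightarrow> f i \<in> Q (Suc i) - Q i" by metis
  define N where "N i = (SOME N. exponents_le N (f i))" for i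
  have N: "exponents_le (N i) (f i)" for i
    unfolding N_def by (rule someI_ex[OF ex_exponents_le])
  define D where "D = (\<Sum>i<n. N i)"
  have D: "exponents_le D (f i)" if "i < n" for i
    using N[of i] member_le_sum[of i "{..<n}" N] that unfolding D_def
    by (auto elim!: exponents_le_mono)
  have fc: "f i \<in> carrier (poly_ring B)" if "i < n" for i
    using f[OF that] primeideal_poly_ringD(1)[OF prime[of "Suc i"]] that by auto
  show ?thesis
  proof (rule le_if_powers_dominated)
    fix M
    have "card (exponent_box n M) \<le> Suc (n * M * D) ^ card B"
    proof (rule card_independent_le[OF assms(1) finite_exponent_box])
      show "independent_mod (Q 0) (exponent_box n M) (power_product f)"
        using prime strict f by (intro power_products_independent_mod[where B = B]) auto
      show "0 \<in> Q 0" by (rule primeideal_poly_ringD(2)[OF prime[of 0]]) simp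
      show "power_product f l \<in> carrier (poly_ring B)" "exponents_le (n * M * D) (power_product f l)"
        if "l \<in> exponent_box n M" for l
        using fc that D
        by (auto intro!: carrier_power_product exponents_le_power_product simp: exponent_box_def)
    qed
    also have "\<dots> \<le> ((n * D + 1) * Suc M) ^ card B"
      by (intro power_mono) (auto simp: algebra_simps)
    finally show "Suc M ^ n \<le> ((n * D + 1) * Suc M) ^ card B" by (simp add: card_exponent_box)
  qed
qed

text \<open>A chain of primes ending in the ideal of the variables in \<open>T\<close> can be prolonged by adjoining the
remaining \<open>card (B - T)\<close> variables one at a time, so the bound on the dimension of the whole ring
bounds its length by \<open>card T\<close>.\<close>

lemma codim_variable_prime_le:
  assumes "finite B" "T \<subseteq> B"
  shows "codim (poly_ring B) (variable_prime B T :: ('b, 'k::field) mpol set) \<le> enat (card T)"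
proof -
  have ext: "n + card (B - T) \<le> card B"
    if "T \<subseteq> B" "\<forall>i\<le>n. primeideal (Q i) (poly_ring B)" "\<forall>i<n. Q i \<subset> Q (Suc i)"
      "Q n = variable_prime B T" for n T and Q :: "nat \<Rightarrow> ('b, 'k) mpol set"
    using that
  proof (induction "card (B - T)" arbitrary: n T Q)
    case 0
    then show ?case using prime_chain_length_le_card[OF assms(1), of n Q] by simp
  next
    case (Suc k)
    then have "B - T \<noteq> {}" by auto
    then obtain t where t: "t \<in> B" "t \<notin> T" by blast
    define Q' where "Q' i = (if i \<le> n then Q i else variable_prime B (insert t T))" for i
    have "B - insert t T = B - T - {t}" by blast
    then have card: "card (B - T) = Suc (card (B - insert t T))"
      using card.remove[of "B - T" t] assms(1) t by simp
    have "monomial (Poly_Mapping.single t 1) \<in> variable_prime B (insert t T) - (variable_prime B T :: ('b, 'k) mpol set)"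
      using t by (auto simp: variable_prime_def in_carrier_poly_ring_iff monomial_def)
    moreover have "variable_prime B T \<subseteq> (variable_prime B (insert t T) :: ('b, 'k) mpol set)"
      by (auto simp: variable_prime_def)
    ultimately have "variable_prime B T \<subset> (variable_prime B (insert t T) :: ('b, 'k) mpol set)" by blast
    then have strict: "\<forall>i<Suc n. Q' i \<subset> Q' (Suc i)"
      using Suc.prems(3,4) by (auto simp: Q'_def less_Suc_eq)
    have prime: "\<forall>i\<le>Suc n. primeideal (Q' i) (poly_ring B)"
      using Suc.prems(2) primeideal_variable_prime[OF assms(1)] by (auto simp: Q'_def)
    have "k = card (B - insert t T)" using Suc.hyps(2) card by simp
    moreover have "insert t T \<subseteq> B" using Suc.prems(1) t by blast
    moreover have "Q' (Suc n) = variable_prime B (insert t T)" by (simp add: Q'_def)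
    ultimately have "Suc n + card (B - insert t T) \<le> card B"
      using strict prime by (intro Suc.hyps(1))
    then show ?case using card by simp
  qed
  show ?thesis
    unfolding codim_def
  proof (rule Sup_least)
    fix h :: enat
    assume "h \<in> {enat n |n. \<exists>Q :: nat \<Rightarrow> ('b, 'k) mpol set. (\<forall>i\<le>n. primeideal (Q i) (poly_ring B)) \<and>
      (\<forall>i<n. Q i \<subset> Q (Suc i)) \<and> Q n = variable_prime B T}"
    then obtain n and Q :: "nat \<Rightarrow> ('b, 'k) mpol set" where h: "h = enat n"
      and Q: "\<forall>i\<le>n. primeideal (Q i) (poly_ring B)" "\<forall>i<n. Q i \<subset> Q (Suc i)" "Q n = variable_prime B T"
      by blast
    have "n \<le> card T"
      using ext[OF assms(2) Q] card_Diff_subset[OF finite_subset[OF assms(2,1)] assms(2)]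
        card_mono[OF assms] by linarith
    then show "h \<le> enat (card T)" by (simp add: h)
  qed
qed

section \<open>Minimal primes of monomial ideals\<close>

lemma monomial_mult: "monomial m * monomial n = (monomial (m + n) :: ('b, 'k::field) mpol)"
  by (simp add: monomial_def mult_single)

lemma prime_contains_variable_of_monomial:
  fixes P :: "('b, 'k::field) mpol set"
  assumes P: "primeideal P (poly_ring B)" and "finite B"
  shows "Poly_Mapping.keys m \<subseteq> B \<Longrightarrow> monomial m \<in> P \<Longrightarrow>
    \<exists>i\<in>Poly_Mapping.keys m. monomial (Poly_Mapping.single i 1) \<in> P"
proof (induction "\<Sum>i\<in>B. Poly_Mapping.lookup m i" arbitrary: m rule: less_induct)
  case less
  note p = primeideal_poly_ringD[OF P]
  have "m \<noteq> 0" using less.prems(2) p(3) by (auto simp: monomial_def)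
  then obtain i where i: "i \<in> Poly_Mapping.keys m" by (meson ex_in_conv keys_eq_empty)
  define n where "n = m - Poly_Mapping.single i 1"
  have m: "m = Poly_Mapping.single i 1 + n"
    using i by (intro poly_mapping_eqI)
      (auto simp: n_def lookup_add lookup_minus lookup_single when_def in_keys_iff)
  have keys: "Poly_Mapping.keys n \<subseteq> Poly_Mapping.keys m" unfolding m keys_add_expo by blast
  have mono: "monomial (Poly_Mapping.single i 1) * monomial n \<in> P"
    using less.prems(2) by (simp only: monomial_mult m[symmetric])
  have "i \<in> B" using i less.prems(1) by blast
  then consider "monomial (Poly_Mapping.single i 1) \<in> P" | "monomial n \<in> P"
    using p(7)[OF _ _ mono] keys less.prems(1)
    by (auto simp: monomial_def in_carrier_poly_ring_iff)
  then show ?case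
  proof cases
    case 1
    with i show ?thesis by blast
  next
    case 2
    have "(\<Sum>i\<in>B. Poly_Mapping.lookup n i) < (\<Sum>i\<in>B. Poly_Mapping.lookup m i)"
      using \<open>i \<in> B\<close> \<open>finite B\<close> by (intro sum_strict_mono_ex1)
        (auto simp: m lookup_add lookup_single when_def intro!: bexI[of _ i])
    then show ?thesis using less.hyps[of n] 2 keys less.prems(1) by blast
  qed
qed

lemma poly_mapping_eq_sum_single:
  "p = (\<Sum>m\<in>Poly_Mapping.keys p. Poly_Mapping.single m (Poly_Mapping.lookup p m))"
  by (rule poly_mapping_eqI) (simp add: lookup_sum lookup_single when_def in_keys_iff)

lemma variable_prime_subset:
  fixes P :: "('b, 'k::field) mpol set"
  assumes P: "primeideal P (poly_ring B)"
    and T: "\<And>i. i \<in> T \<Longrightarrow> monomial (Poly_Mapping.single i 1) \<in> P"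
  shows "variable_prime B T \<subseteq> P"
proof
  fix p :: "('b, 'k) mpol" assume p: "p \<in> variable_prime B T"
  note P' = primeideal_poly_ringD[OF P]
  have part: "Poly_Mapping.single m (Poly_Mapping.lookup p m) \<in> P" if mem: "m \<in> Poly_Mapping.keys p" for m
  proof -
    obtain i where i: "i \<in> Poly_Mapping.keys m" "i \<in> T"
      using p mem by (auto simp: variable_prime_def)
    have m: "m = (m - Poly_Mapping.single i 1) + Poly_Mapping.single i 1"
      using i by (intro poly_mapping_eqI)
        (auto simp: lookup_add lookup_minus lookup_single when_def in_keys_iff)
    have "Poly_Mapping.keys (m - Poly_Mapping.single i 1) \<subseteq> Poly_Mapping.keys m"
      by (subst (2) m) (auto simp: keys_add_expo)
    moreover have "Poly_Mapping.keys m \<subseteq> B"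
      using p mem by (auto simp: variable_prime_def in_carrier_poly_ring_iff)
    ultimately have "Poly_Mapping.single (m - Poly_Mapping.single i 1) (Poly_Mapping.lookup p m)
        \<in> carrier (poly_ring B)"
      by (auto simp: in_carrier_poly_ring_iff)
    from P'(6)[OF T[OF i(2)] this] show ?thesis
      by (simp only: monomial_def mult_single m[symmetric] mult_1_right)
  qed
  have "(\<Sum>m\<in>K. Poly_Mapping.single m (Poly_Mapping.lookup p m)) \<in> P"
    if "finite K" "K \<subseteq> Poly_Mapping.keys p" for K
    using that by (induction K) (auto intro: P'(2,4) part)
  from this[of "Poly_Mapping.keys p"] show "p \<in> P"
    by (simp flip: poly_mapping_eq_sum_single)
qed

text \<open>A prime that contains a monomial contains one of its variables. So the variables in a prime over a
monomial ideal meet every generator, and they generate a prime that still contains the ideal. A minimal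
prime is therefore generated by such a set \<open>T\<close> of variables. If \<open>T\<close> without \<open>t\<close> also met every
generator, it would generate a smaller prime, so \<open>t\<close> is the only variable of \<open>T\<close> in some generator.\<close>

lemma minimal_prime_of_label_ideal:
  fixes I P :: "('b, 'k::field) mpol set"
  assumes B: "finite B" and a: "\<And>v. v \<in> vertices X \<Longrightarrow> Poly_Mapping.keys (a v) \<subseteq> B"
    and I: "I = label_ideal B X a" and P: "minimal_prime (poly_ring B) I P"
  obtains T where "T \<subseteq> B" "P = variable_prime B T"
    "\<And>v. v \<in> vertices X \<Longrightarrow> Poly_Mapping.keys (a v) \<inter> T \<noteq> {}"
    "\<And>t. t \<in> T \<Longrightarrow> \<exists>v\<in>vertices X. Poly_Mapping.keys (a v) \<inter> T = {t}"
proof -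
  interpret R: cring "poly_ring B :: ('b, 'k) mpol ring" by (rule cring_poly_ring)
  have prime: "primeideal P (poly_ring B)" and IP: "I \<subseteq> P"
    and min: "\<And>Q. primeideal Q (poly_ring B) \<Longrightarrow> I \<subseteq> Q \<Longrightarrow> Q \<subseteq> P \<Longrightarrow> Q = P"
    using P by (auto simp: minimal_prime_def)
  define T where "T = {i\<in>B. monomial (Poly_Mapping.single i 1) \<in> P}"
  have gens: "(\<lambda>v. monomial (a v)) ` vertices X \<subseteq> carrier (poly_ring B :: ('b, 'k) mpol ring)"
    using a by (auto simp: in_carrier_poly_ring_iff monomial_def)
  have meets: "Poly_Mapping.keys (a v) \<inter> T \<noteq> {}" if v: "v \<in> vertices X" for v
  proof -
    have "monomial (a v) \<in> P"
      using R.genideal_self[OF gens] v IP by (auto simp: I label_ideal_def)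
    from prime_contains_variable_of_monomial[OF prime B a[OF v] this] a[OF v]
    show ?thesis by (auto simp: T_def)
  qed
  have I_sub: "I \<subseteq> variable_prime B U"
    if "\<And>v. v \<in> vertices X \<Longrightarrow> Poly_Mapping.keys (a v) \<inter> U \<noteq> {}" for U
    unfolding I label_ideal_def
  proof (rule R.genideal_minimal)
    show "ideal (variable_prime B U) (poly_ring B :: ('b, 'k) mpol ring)"
      using primeideal_variable_prime[OF B] by (rule primeideal.axioms(1))
    show "(\<lambda>v. monomial (a v)) ` vertices X \<subseteq> (variable_prime B U :: ('b, 'k) mpol set)"
      using that subsetD[OF a] by (auto simp: variable_prime_def in_carrier_poly_ring_iff monomial_def)
  qed
  have sub: "variable_prime B U \<subseteq> P" if "U \<subseteq> T" for U
    using that by (intro variable_prime_subset[OF prime]) (auto simp: T_def)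
  have P_eq: "variable_prime B T = P"
    by (rule min[OF primeideal_variable_prime[OF B] I_sub[OF meets] sub]) auto
  have only: "\<exists>v\<in>vertices X. Poly_Mapping.keys (a v) \<inter> T = {t}" if t: "t \<in> T" for t
  proof (rule ccontr)
    assume no: "\<not> ?thesis"
    have "Poly_Mapping.keys (a v) \<inter> (T - {t}) \<noteq> {}" if "v \<in> vertices X" for v
      using meets[OF that] no that t by blast
    then have "variable_prime B (T - {t}) = P"
      by (intro min[OF primeideal_variable_prime[OF B] I_sub sub]) auto
    moreover have "monomial (Poly_Mapping.single t 1) \<in> P" using t by (simp add: T_def)
    ultimately have "monomial (Poly_Mapping.single t 1) \<in> (variable_prime B (T - {t}) :: ('b, 'k) mpol set)"
      by simp
    then show False by (simp add: variable_prime_def monomial_def)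
  qed
  show thesis
    by (rule that[of T]) (use P_eq meets only in \<open>auto simp: T_def\<close>)
qed

section \<open>Multigraded parts of a cellular resolution\<close>

text \<open>The incidence matrix of the reduced chain complex of the faces with coefficients in the field \<open>'k\<close>.
The empty face has dimension \<open>-1\<close>, so the augmentation is included.\<close>

definition signed_incidence :: "('a::euclidean_space set \<Rightarrow> 'a set \<Rightarrow> int) \<Rightarrow> 'a set \<Rightarrow> 'a set \<Rightarrow> 'k::field" where
  "signed_incidence \<epsilon> G F = (if is_facet G F then of_int (\<epsilon> G F) else 0)"

lemma based_complex_faces:
  assumes X: "polyhedral_complex X" and \<epsilon>: "incidence_signs X \<epsilon>"
  shows "based_complex X aff_dim (signed_incidence \<epsilon> :: 'a::euclidean_space set \<Rightarrow> 'a set \<Rightarrow> 'k::field)"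
  unfolding based_complex_def
proof (intro conjI ballI impI)
  show fin: "finite X" using X by (simp add: polyhedral_complex_def)
  show "aff_dim G = aff_dim F - 1" if "(signed_incidence \<epsilon> G F :: 'k) \<noteq> 0" for F G
    using that by (simp add: signed_incidence_def is_facet_def split: if_splits)
  fix F H assume FH: "F \<in> X" "H \<in> X"
  have sub: "{G. is_facet H G \<and> is_facet G F} \<subseteq> X"
    using X FH by (auto simp: polyhedral_complex_def is_facet_def)
  have "(\<Sum>G\<in>X. signed_incidence \<epsilon> H G * signed_incidence \<epsilon> G F :: 'k)
      = (\<Sum>G | is_facet H G \<and> is_facet G F. of_int (\<epsilon> H G * \<epsilon> G F))"
    using fin sub by (intro sum.mono_neutral_cong_right) (auto simp: signed_incidence_def)
  also have "\<dots> = of_int (\<Sum>G | is_facet H G \<and> is_facet G F. \<epsilon> H G * \<epsilon> G F)"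
    by (simp only: of_int_sum)
  also have "\<dots> = 0" using \<epsilon> FH by (simp add: incidence_signs_def)
  finally show "(\<Sum>G\<in>X. signed_incidence \<epsilon> H G * signed_incidence \<epsilon> G F :: 'k) = 0" .
qed

lemma lookup_face_expo:
  assumes "polytope F"
  shows "Poly_Mapping.lookup (face_expo a F) i =
    Max (insert 0 ((\<lambda>v. Poly_Mapping.lookup (a v) i) ` {v. v extreme_point_of F}))"
proof -
  have "finite {v. v extreme_point_of F}"
    using assms by (intro finite_polyhedron_extreme_points polytope_imp_polyhedron)
  then show ?thesis
    unfolding face_expo_def by (subst lookup_lcm_expo) (auto simp: image_image Max_insert)
qed

lemma face_expo_le_iff:
  assumes "polytope F"
  shows "Poly_Mapping.lookup (face_expo a F) i \<le> n \<longleftrightarrow>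
    (\<forall>v. v extreme_point_of F \<longrightarrow> Poly_Mapping.lookup (a v) i \<le> n)"
proof -
  have "finite {v. v extreme_point_of F}"
    using assms by (intro finite_polyhedron_extreme_points polytope_imp_polyhedron)
  then show ?thesis unfolding lookup_face_expo[OF assms] by (subst Max_le_iff) auto
qed

lemma face_expo_mono:
  assumes "polytope F" "G face_of F"
  shows "Poly_Mapping.lookup (face_expo a G) i \<le> Poly_Mapping.lookup (face_expo a F) i"
proof -
  have "polytope G" using assms by (rule face_of_polytope_polytope)
  then show ?thesis
    using face_expo_le_iff[of F a i "Poly_Mapping.lookup (face_expo a F) i"] assms
      extreme_point_of_face[OF assms(2)]
    by (subst face_expo_le_iff) auto
qed

lemma keys_face_expo:
  assumes "polytope F"
  shows "Poly_Mapping.keys (face_expo a F) = (\<Union>v\<in>{v. v extreme_point_of F}. Poly_Mapping.keys (a v))"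
  using face_expo_le_iff[OF assms, of a _ 0] by (auto simp: in_keys_iff)

text \<open>The subcomplex of the faces whose label divides \<open>x ^ b\<close>. The part of the cellular complex in
multidegree \<open>b\<close> has one copy of the field, spanned by \<open>x ^ (b - label F) F\<close>, for each such face
\<open>F\<close>, and its differential is the boundary of the reduced chain complex.\<close>

definition strand :: "'a::euclidean_space set set \<Rightarrow> ('a \<Rightarrow> 'b expo) \<Rightarrow> 'b expo \<Rightarrow> 'a set set" where
  "strand X a b = {F\<in>X. \<forall>i. Poly_Mapping.lookup (face_expo a F) i \<le> Poly_Mapping.lookup b i}"

lemma lookup_mult_single:
  fixes p :: "('b, 'k::field) mpol"
  shows "Poly_Mapping.lookup (p * Poly_Mapping.single n c) (m + n) = Poly_Mapping.lookup p m * c"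
  by (subst lookup_mult_unique) (auto split: if_splits)

text \<open>Exactness of the cellular complex is inherited by its multigraded parts: a cycle of faces is
homogenised to multidegree \<open>b\<close>, lifted in the cellular complex, and the lift is replaced by its
component of multidegree \<open>b\<close>.\<close>

lemma exact_at_strand:
  fixes I :: "('b, 'k::field) mpol set"
  assumes X: "polyhedral_complex X" and res: "cellular_resolution B X \<epsilon> a I"
    and b: "Poly_Mapping.keys b \<subseteq> B" and i: "i \<ge> 0"
  shows "exact_at (strand X a b) aff_dim (signed_incidence \<epsilon> :: 'a::euclidean_space set \<Rightarrow> 'a set \<Rightarrow> 'k) i"
  unfolding exact_at_def
proof (intro allI impI, elim conjE)
  let ?Y = "strand X a b" and ?inc = "signed_incidence \<epsilon> :: 'a set \<Rightarrow> 'a set \<Rightarrow> 'k"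
  define e where "e = face_expo a"
  have fin: "finite X" and face: "\<And>F G. F \<in> X \<Longrightarrow> G face_of F \<Longrightarrow> G \<in> X"
    and poly: "\<And>F. F \<in> X \<Longrightarrow> polytope F"
    using X unfolding polyhedral_complex_def by blast+
  have YX: "?Y \<subseteq> X" by (auto simp: strand_def)
  have le: "Poly_Mapping.lookup (e F) j \<le> Poly_Mapping.lookup b j" if "F \<in> ?Y" for F j
    using that by (simp add: strand_def e_def)
  have mono: "Poly_Mapping.lookup (e G) j \<le> Poly_Mapping.lookup (e F) j" if "F \<in> X" "is_facet G F" for F G j
    using that face_expo_mono[OF poly, of F G a j] by (simp add: e_def is_facet_def)
  have facetX: "G \<in> X" if "F \<in> X" "is_facet G F" for F G
    using that face by (auto simp: is_facet_def)
  have facetY: "G \<in> ?Y" if "F \<in> ?Y" "is_facet G F" for F G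
    using that facetX[of F G] mono[of F G] le[of F] YX le_trans
    unfolding strand_def e_def by blast
  have add: "(b - e F) + (e F - e G) = b - e G" if "F \<in> ?Y" "is_facet G F" for F G
  proof (rule poly_mapping_eqI)
    fix j
    show "Poly_Mapping.lookup ((b - e F) + (e F - e G)) j = Poly_Mapping.lookup (b - e G) j"
      using le[OF that(1), of j] mono[of F G j] that YX by (auto simp: lookup_add lookup_minus)
  qed
  fix c :: "'a set \<Rightarrow> 'k"
  assume c: "cell_chain ?Y aff_dim i c" and cyc: "cell_bd ?Y ?inc c = (\<lambda>_. 0)"
  have c0: "c F = 0" if "F \<notin> ?Y" for F using c that by (auto simp: cell_chain_def)
  \<comment> \<open>The homogenisation of c, and below, k, the component of multidegree b of its lift h.\<close>
  define c' where "c' F = Poly_Mapping.single (b - e F) (c F)" for F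
  have sum0: "(\<Sum>F | F \<in> X \<and> is_facet G F. ?inc G F * c F) = 0" for G
  proof (cases "G \<in> ?Y")
    case True
    have "(\<Sum>F | F \<in> X \<and> is_facet G F. ?inc G F * c F) = (\<Sum>F\<in>X. ?inc G F * c F)"
      using fin by (intro sum.mono_neutral_left) (auto simp: signed_incidence_def)
    also have "\<dots> = (\<Sum>F\<in>?Y. ?inc G F * c F)"
      using fin YX c0 by (intro sum.mono_neutral_right) auto
    also have "\<dots> = 0" using fun_cong[OF cyc, of G] True by (simp add: cell_bd_def)
    finally show ?thesis .
  next
    case False
    then show ?thesis using facetY c0 by (intro sum.neutral) auto
  qed
  have bd_c': "boundary X \<epsilon> a c' = (\<lambda>_. 0)"
  proof
    fix G
    have "boundary X \<epsilon> a c' G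
        = (\<Sum>F | F \<in> X \<and> is_facet G F. Poly_Mapping.single (b - e G) (?inc G F * c F))"
      unfolding boundary_def
    proof (rule sum.cong[OF refl])
      fix F assume F: "F \<in> {F. F \<in> X \<and> is_facet G F}"
      show "c' F * (of_int (\<epsilon> G F) * monomial (face_expo a F - face_expo a G))
        = Poly_Mapping.single (b - e G) (?inc G F * c F)"
      proof (cases "F \<in> ?Y")
        case True
        then show ?thesis
          using F add[OF True, of G]
          by (simp add: c'_def e_def[symmetric] signed_incidence_def monomial_def mult_single
              mult.commute flip: single_of_int)
      qed (simp add: c'_def c0)
    qed
    also have "\<dots> = Poly_Mapping.single (b - e G) (\<Sum>F | F \<in> X \<and> is_facet G F. ?inc G F * c F)"
      by (rule poly_mapping_eqI) (simp add: lookup_sum lookup_single when_def)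
    finally show "boundary X \<epsilon> a c' G = 0" by (simp add: sum0)
  qed
  have "c' F \<in> carrier (poly_ring B)" for F
  proof -
    have "Poly_Mapping.keys (b - e F) \<subseteq> Poly_Mapping.keys b"
      by (auto simp: in_keys_iff lookup_minus)
    then show ?thesis using b by (auto simp: c'_def in_carrier_poly_ring_iff)
  qed
  moreover have "c F \<noteq> 0" if "c' F \<noteq> 0" for F using that by (auto simp: c'_def)
  ultimately have "c' \<in> chains B X i"
    using c YX unfolding chains_def cell_chain_def by blast
  with bd_c' have "c' \<in> boundary X \<epsilon> a ` chains B X (i + 1)"
    using res i unfolding cellular_resolution_def by blast
  then obtain h where h: "h \<in> chains B X (i + 1)" "c' = boundary X \<epsilon> a h" by blast
  define k where "k F = (if F \<in> ?Y then Poly_Mapping.lookup (h F) (b - e F) else 0)" for F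
  have "cell_chain ?Y aff_dim (i + 1) k"
    using h(1) lookup_zero unfolding cell_chain_def k_def chains_def by (smt (verit) mem_Collect_eq)
  moreover have "cell_bd ?Y ?inc k G = c G" for G
  proof (cases "G \<in> ?Y")
    case True
    have "c G = Poly_Mapping.lookup (boundary X \<epsilon> a h G) (b - e G)"
      by (simp flip: h(2)) (simp add: c'_def)
    also have "\<dots> = (\<Sum>F | F \<in> X \<and> is_facet G F.
        Poly_Mapping.lookup (h F * (of_int (\<epsilon> G F) * monomial (e F - e G))) (b - e G))"
      by (simp add: boundary_def lookup_sum e_def)
    also have "\<dots> = (\<Sum>F | F \<in> X \<and> is_facet G F. ?inc G F * k F)"
    proof (rule sum.cong[OF refl])
      fix F assume F: "F \<in> {F. F \<in> X \<and> is_facet G F}"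
      have single: "of_int (\<epsilon> G F) * monomial (e F - e G)
          = Poly_Mapping.single (e F - e G) (of_int (\<epsilon> G F) :: 'k)"
        by (simp add: monomial_def mult_single flip: single_of_int)
      show "Poly_Mapping.lookup (h F * (of_int (\<epsilon> G F) * monomial (e F - e G))) (b - e G) = ?inc G F * k F"
      proof (cases "F \<in> ?Y")
        case True
        then show ?thesis
          using F lookup_mult_single[of "h F" "e F - e G" _ "b - e F"] add[OF True, of G]
          by (simp add: single k_def signed_incidence_def)
      next
        case False
        then obtain j where j: "Poly_Mapping.lookup b j < Poly_Mapping.lookup (e F) j"
          using F by (auto simp: strand_def e_def not_le)
        have "Poly_Mapping.lookup (h F * Poly_Mapping.single (e F - e G) (of_int (\<epsilon> G F))) (b - e G) = 0"
        proof (rule lookup_mult_eq_0, rule notI)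
          fix s t assume t: "t \<in> Poly_Mapping.keys (Poly_Mapping.single (e F - e G) (of_int (\<epsilon> G F) :: 'k))"
            and st: "s + t = b - e G"
          have "t = e F - e G" using t by (auto split: if_splits)
          then have "Poly_Mapping.lookup s j + (Poly_Mapping.lookup (e F) j - Poly_Mapping.lookup (e G) j)
              = Poly_Mapping.lookup b j - Poly_Mapping.lookup (e G) j"
            using arg_cong[OF st, of "\<lambda>m. Poly_Mapping.lookup m j"] by (simp add: lookup_add lookup_minus)
          then show False using j le[OF \<open>G \<in> ?Y\<close>, of j] by linarith
        qed
        then show ?thesis using False by (simp add: single k_def)
      qed
    qed
    also have "\<dots> = (\<Sum>F\<in>X. ?inc G F * k F)"
      using fin by (intro sum.mono_neutral_left) (auto simp: signed_incidence_def)
    also have "\<dots> = (\<Sum>F\<in>?Y. ?inc G F * k F)"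
      using fin YX by (intro sum.mono_neutral_right) (auto simp: k_def)
    finally show ?thesis using True by (simp add: cell_bd_def)
  next
    case False
    then show ?thesis by (simp add: cell_bd_def c0)
  qed
  ultimately show "\<exists>k. cell_chain ?Y aff_dim (i + 1) k \<and> cell_bd ?Y ?inc k = c" by blast
qed

text \<open>A vertex bounds the empty face, so a complex with a vertex has no reduced homology in degree \<open>-1\<close>.\<close>

lemma exact_at_negative_degree:
  fixes Y :: "'a::euclidean_space set set"
  assumes "finite Y" and v: "{v} \<in> Y" "{} \<in> Y" and \<epsilon>: "\<epsilon> {} {v} = 1" and i: "i < 0"
  shows "exact_at Y aff_dim (signed_incidence \<epsilon> :: 'a set \<Rightarrow> 'a set \<Rightarrow> 'k::field) i"
  unfolding exact_at_def
proof (intro allI impI, elim conjE)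
  fix c :: "'a set \<Rightarrow> 'k" assume c: "cell_chain Y aff_dim i c"
  have c0: "c F = 0" if "F \<noteq> {}" for F
    using c i that aff_dim_negative_iff[of F] by (auto simp: cell_chain_def)
  have inc: "signed_incidence \<epsilon> G {v} = (if G = {} then 1 else 0 :: 'k)" for G
    using \<epsilon> by (auto simp: signed_incidence_def is_facet_def aff_dim_empty[symmetric])
  define k where "k F = (if F = {v} then c {} else 0)" for F
  have "cell_chain Y aff_dim (i + 1) k"
    using c v by (auto simp: cell_chain_def k_def)
  moreover have "cell_bd Y (signed_incidence \<epsilon>) k G = c G" for G
  proof -
    have "(\<Sum>F\<in>Y. signed_incidence \<epsilon> G F * k F) = (\<Sum>F\<in>Y. if F = {v} then signed_incidence \<epsilon> G {v} * c {} else 0)"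
      by (intro sum.cong) (auto simp: k_def)
    also have "\<dots> = c G" using assms(1) v(1) c0[of G] by (auto simp: inc)
    finally show ?thesis using v(2) c0[of G] by (auto simp: cell_bd_def)
  qed
  ultimately show "\<exists>k. cell_chain Y aff_dim (i + 1) k \<and> cell_bd Y (signed_incidence \<epsilon>) k = c" by blast
qed

lemma not_exact_at_empty_face:
  fixes \<epsilon> :: "'a::euclidean_space set \<Rightarrow> 'a set \<Rightarrow> int"
  shows "\<not> exact_at {{}} aff_dim (signed_incidence \<epsilon> :: 'a set \<Rightarrow> 'a set \<Rightarrow> 'k::field) (- 1)"
proof
  let ?inc = "signed_incidence \<epsilon> :: 'a set \<Rightarrow> 'a set \<Rightarrow> 'k"
  assume ex: "exact_at {{}} aff_dim ?inc (- 1)"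
  define c :: "'a set \<Rightarrow> 'k" where "c F = (if F = {} then 1 else 0)" for F
  have "cell_chain {{}} aff_dim (- 1) c" by (auto simp: cell_chain_def c_def)
  moreover have "cell_bd {{}} ?inc c = (\<lambda>_. 0)"
    by (auto simp: cell_bd_def signed_incidence_def is_facet_def)
  ultimately obtain k where k: "cell_chain {{}} aff_dim 0 k" "cell_bd {{}} ?inc k = c"
    using ex unfolding exact_at_def by fastforce
  have "k {} = 0" using k(1) by (force simp: cell_chain_def)
  then have "c {} = 0" by (simp flip: k(2)) (simp add: cell_bd_def)
  then show False by (simp add: c_def)
qed

lemma lookup_avoidance_label:
  assumes "finite B"
  shows "Poly_Mapping.lookup (avoidance_label B C v) i = (if i \<in> B \<and> v \<notin> vertices (C i) then 1 else 0)"
  unfolding avoidance_label_def lookup_sum lookup_single when_def using assms by simp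

text \<open>This is the Helly argument for the subcomplexes of the faces whose label is prime to \<open>x\<^sub>t\<close>, for
\<open>t \<in> T\<close>. The intersection over a set \<open>A\<close> is the strand of the product of the variables outside \<open>A\<close>, as the
labels are square free.
For a proper subset \<open>A\<close> of \<open>T\<close> it is acyclic: in nonnegative degrees by the resolution, and in degree
\<open>-1\<close> because a vertex whose label meets \<open>T\<close> only outside \<open>A\<close> lies in it. For \<open>A = T\<close> no vertex is
left, so only the empty face remains, and it carries homology in degree \<open>-1\<close>.\<close>

lemma ex_face_of_dimension_card_minus_one:
  fixes X :: "'a::euclidean_space set set" and I :: "('b, 'k::field) mpol set"
  assumes X: "polyhedral_complex X" and B: "finite B" and \<epsilon>: "incidence_signs X \<epsilon>"
    and a: "\<And>v i. Poly_Mapping.lookup (a v) i \<le> (if i \<in> B then 1 else 0)"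
    and res: "cellular_resolution B X \<epsilon> a I"
    and T: "T \<subseteq> B" "\<And>v. v \<in> vertices X \<Longrightarrow> Poly_Mapping.keys (a v) \<inter> T \<noteq> {}"
      "\<And>t. t \<in> T \<Longrightarrow> \<exists>v\<in>vertices X. Poly_Mapping.keys (a v) \<inter> T = {t}"
  shows "\<exists>F\<in>X. aff_dim F = int (card T) - 1"
proof -
  let ?inc = "signed_incidence \<epsilon> :: 'a set \<Rightarrow> 'a set \<Rightarrow> 'k"
  define \<tau> where "\<tau> F = Poly_Mapping.keys (face_expo a F)" for F
  have fin: "finite X" and face: "\<And>F G. F \<in> X \<Longrightarrow> G face_of F \<Longrightarrow> G \<in> X"
    and poly: "\<And>F. F \<in> X \<Longrightarrow> polytope F"
    using X unfolding polyhedral_complex_def by blast+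
  \<comment> \<open>The complex contains the empty face because the resolution reaches 1 in the coefficient ring.\<close>
  obtain c where c: "c \<in> chains B X (- 1)" "c {} = (1 :: ('b, 'k) mpol)"
  proof -
    have "(1 :: ('b, 'k) mpol) \<in> (\<lambda>c. c {}) ` chains B X (- 1)"
      using res carrier_one[of B] unfolding cellular_resolution_def by blast
    then show thesis using that by fastforce
  qed
  then have "c {} \<noteq> 0" by simp
  then have empty: "{} \<in> X" using c(1) unfolding chains_def by blast
  have \<tau>_empty: "\<tau> {} = {}" unfolding \<tau>_def by (subst keys_face_expo) (use poly[OF empty] in simp_all)
  have \<tau>_point: "\<tau> {v} = Poly_Mapping.keys (a v)" for v
    by (simp add: \<tau>_def keys_face_expo polytope_sing)
  have label: "Poly_Mapping.lookup (face_expo a F) i \<le> (if i \<in> B then 1 else 0)" if "F \<in> X" for F i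
    using a by (subst face_expo_le_iff[OF poly[OF that]]) blast
  have strand: "{F\<in>X. \<tau> F \<inter> A = {}} = strand X a (\<Sum>i\<in>B - A. Poly_Mapping.single i 1)"
    if "A \<subseteq> B" for A
  proof -
    have b: "Poly_Mapping.lookup (\<Sum>i\<in>B - A. Poly_Mapping.single i 1) i = (if i \<in> B - A then 1 else (0::nat))" for i
      unfolding lookup_sum lookup_single when_def using B by simp
    have "\<tau> F \<inter> A = {} \<longleftrightarrow> (\<forall>i. Poly_Mapping.lookup (face_expo a F) i \<le> (if i \<in> B - A then 1 else 0))"
      if "F \<in> X" for F
    proof
      assume *: "\<tau> F \<inter> A = {}"
      show "\<forall>i. Poly_Mapping.lookup (face_expo a F) i \<le> (if i \<in> B - A then 1 else 0)"
      proof
        fix i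
        show "Poly_Mapping.lookup (face_expo a F) i \<le> (if i \<in> B - A then 1 else 0)"
          using label[OF that, of i] * by (cases "i \<in> A") (auto simp: \<tau>_def in_keys_iff)
      qed
    next
      assume *: "\<forall>i. Poly_Mapping.lookup (face_expo a F) i \<le> (if i \<in> B - A then 1 else 0)"
      have "i \<notin> \<tau> F" if "i \<in> A" for i
        using spec[OF *, of i] that by (simp add: \<tau>_def in_keys_iff)
      then show "\<tau> F \<inter> A = {}" by blast
    qed
    then show ?thesis unfolding strand_def b by blast
  qed
  have "\<exists>F\<in>X. T \<subseteq> \<tau> F \<and> aff_dim F = - 1 + int (card T)"
  proof (rule exists_cell_outside_acyclic_cover)
    show "finite T" using T(1) B by (rule finite_subset)
    show "based_complex X aff_dim ?inc" by (rule based_complex_faces[OF X \<epsilon>])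
    show "\<tau> G \<subseteq> \<tau> F" if "F \<in> X" "G \<in> X" "?inc G F \<noteq> 0" for F G
    proof
      fix i assume "i \<in> \<tau> G"
      moreover have "G face_of F" using that by (auto simp: signed_incidence_def is_facet_def split: if_splits)
      ultimately show "i \<in> \<tau> F"
        using face_expo_mono[OF poly[OF that(1)], of G a i] by (simp add: \<tau>_def in_keys_iff)
    qed
    show "exact_at {F\<in>X. \<tau> F \<inter> A = {}} aff_dim ?inc i" if A: "A \<subset> T" for A i
    proof (cases "i \<ge> 0")
      case True
      have "Poly_Mapping.keys (\<Sum>i\<in>B - A. Poly_Mapping.single i (1::nat)) \<subseteq> B"
        using B by (auto simp: in_keys_iff lookup_sum lookup_single when_def split: if_splits)
      moreover have "A \<subseteq> B" using A T(1) by blast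
      ultimately show ?thesis unfolding strand[OF \<open>A \<subseteq> B\<close>] using exact_at_strand[OF X res _ True] by blast
    next
      case False
      obtain t where t: "t \<in> T" "t \<notin> A" using A by blast
      then obtain v where v: "{v} \<in> X" "Poly_Mapping.keys (a v) \<inter> T = {t}"
        using T(3)[OF t(1)] by (auto simp: vertices_def)
      show ?thesis
      proof (rule exact_at_negative_degree)
        show "{v} \<in> {F\<in>X. \<tau> F \<inter> A = {}}" using v t A by (auto simp: \<tau>_point)
        show "\<epsilon> {} {v} = 1" using \<epsilon> v(1) by (simp add: incidence_signs_def vertices_def)
      qed (use fin empty \<tau>_empty False in auto)
    qed
    have "\<tau> F \<inter> T \<noteq> {}" if F: "F \<in> X" "F \<noteq> {}" for F
    proof -
      have "compact F" "convex F" using poly[OF F(1)] by (auto simp: polytope_imp_compact polytope_imp_convex)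
      then obtain v where v: "v extreme_point_of F"
        using extreme_point_exists_convex[of F] F(2) by blast
      then have "{v} \<in> X" using face[OF F(1)] by (simp add: face_of_singleton)
      then have "Poly_Mapping.keys (a v) \<inter> T \<noteq> {}" using T(2) by (simp add: vertices_def)
      then show ?thesis using v poly[OF F(1)] by (auto simp: \<tau>_def keys_face_expo)
    qed
    then have "{F\<in>X. \<tau> F \<inter> T = {}} = {{}}" using empty \<tau>_empty by auto
    then show "\<not> exact_at {F\<in>X. \<tau> F \<inter> T = {}} aff_dim ?inc (- 1)"
      using not_exact_at_empty_face by simp
  qed
  then show ?thesis by auto
qed

section \<open>The codimension bound\<close>

theorem theorem2p7:
  fixes X :: "'a::euclidean_space set set"
    and d :: nat
    and B :: "'b set"
    and C :: "'b \<Rightarrow> 'a set set"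
    and \<epsilon> :: "'a set \<Rightarrow> 'a set \<Rightarrow> int"
    and I P :: "('b, 'k::field) mpol set"
  assumes "polyhedral_complex X"
    and "\<exists>f. embedding_map (top_of_set (\<Union>X)) (Euclidean_space d) f"
    and "finite B"
    and "\<And>i. i \<in> B \<Longrightarrow> induced_subcomplex X (C i)"
    and "incidence_signs X \<epsilon>"
    and "I = label_ideal B X (avoidance_label B C)"
    and "cellular_resolution B X \<epsilon> (avoidance_label B C) I"
    and "minimal_prime (poly_ring B) I P"
  shows "codim (poly_ring B) P \<le> enat (d + 1)"
proof -
  let ?a = "avoidance_label B C"
  have "Poly_Mapping.keys (?a v) \<subseteq> B" for v
    by (auto simp: in_keys_iff lookup_avoidance_label[OF assms(3)] split: if_splits)
  then obtain T where T: "T \<subseteq> B" "P = variable_prime B T"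
    "\<And>v. v \<in> vertices X \<Longrightarrow> Poly_Mapping.keys (?a v) \<inter> T \<noteq> {}"
    "\<And>t. t \<in> T \<Longrightarrow> \<exists>v\<in>vertices X. Poly_Mapping.keys (?a v) \<inter> T = {t}"
    using minimal_prime_of_label_ideal[OF assms(3) _ assms(6,8)] by metis
  have "Poly_Mapping.lookup (?a v) i \<le> (if i \<in> B then 1 else 0)" for v i
    by (simp add: lookup_avoidance_label[OF assms(3)])
  then obtain F where F: "F \<in> X" "aff_dim F = int (card T) - 1"
    using ex_face_of_dimension_card_minus_one[OF assms(1,3,5) _ assms(7) T(1,3,4)] by blast
  obtain f where "embedding_map (top_of_set (\<Union>X)) (Euclidean_space d) f" using assms(2) by blast
  from aff_dim_face_le_embedding[OF assms(1) F(1) this] F(2) have "card T \<le> d + 1" by simp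
  then have "enat (card T) \<le> enat (d + 1)" by simp
  then show ?thesis
    using codim_variable_prime_le[OF assms(3) T(1)] unfolding T(2) by (rule order_trans[rotated])
qed

end
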